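(* Let $\Lambda$ be an Artin algebra and let $C$ be an arbitrary finitely generated $\Lambda$-module. Let $P_1\xrightarrow{\alpha}P_0\to C\to 0$ be the minimal projective presentation of $C$. Then $\tau_{\mathcal H}(C\to 0)\simeq(\nu P_1\xrightarrow{\nu(\alpha)}\nu P_0)$ in the morphism category $\mathcal H$ of $\Lambda$.
   Context: $\mathrm{mod}\,\Lambda$ is the category of finitely generated left $\Lambda$-modules, $D:\mathrm{mod}\,\Lambda\to\mathrm{mod}\,\Lambda^{\mathrm{op}}$ the standard duality, $(-)^*=\mathrm{Hom}_\Lambda(-,\Lambda)$, and $\nu=D\,\mathrm{Hom}_\Lambda(-,\Lambda)$ the Nakayama functor. The morphism category $\mathcal H=H(\Lambda)$ has as objects the maps $(A\xrightarrow{f}B)$ in $\mathrm{mod}\,\Lambda$; a morphism from $(A\xrightarrow{f}B)$ to $(C\xrightarrow{g}D)$ is a pair $(h_1,h_2)$ with $h_1:A\to C$, $h_2:B\to D$, $gh_1=h_2f$. It is equivalent to the category of finitely generated modules over $T_2(\Lambda)=\begin{pmatrix}\Lambda&\Lambda\\0&\Lambda\end{pmatrix}$, and $\tau_{\mathcal H}$ denotes the Auslander-Reiten translation of $\mathcal H$. Explicitly: for $\mathbb X=(X\xrightarrow{f}Y)$ put $\mathbb X^*_{\mathcal H}=(\mathrm{Ker}(f^* )\hookrightarrow Y^* )$ and $D_{\mathcal H}(\mathbb X)=(D(Y)\xrightarrow{D(f)}D(X))$, contravariant functors from $\mathcal H$ to the morphism category of $\Lambda^{\mathrm{op}}$ (and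 similarly in the other direction); if $\mathbb P_1\xrightarrow{g}\mathbb P_0\to\mathbb X\to0$ is the minimal projective presentation of $\mathbb X$ in $\mathcal H$, then $\tau_{\mathcal H}(\mathbb X)$ is the kernel of $D_{\mathcal H}(g)^*_{\mathcal H}:D_{\mathcal H}(\mathbb P_1)^*_{\mathcal H}\to D_{\mathcal H}(\mathbb P_0)^*_{\mathcal H}$, i.e. $\tau_{\mathcal H}(\mathbb X)=D_{\mathcal H}\mathrm{Coker}(g^*_{\mathcal H})$. *)

theory Defs
  imports "HOL-Algebra.Module" "HOL-Algebra.QuotRing"
begin

section \<open>Modules over a not necessarily commutative ring\<close>

text \<open>
  The locale \<^locale>\<open>module\<close> requires a commutative ring of scalars; its record type and the
  locale \<^locale>\<open>submodule\<close> do not. The ring multiplication and unit in the module record are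
  irrelevant throughout.

  A right module over \<open>L\<close> is stored as a left module over \<open>opposite L\<close>: its field \<^const>\<open>smult\<close>
  maps \<open>l\<close> and \<open>x\<close> to the product of \<open>x\<close> with \<open>l\<close> on the right.
\<close>

locale left_module = L?: ring L + M?: abelian_group M for L (structure) and M (structure) +
  assumes smult_closed [simp, intro]:
      "\<lbrakk> a \<in> carrier L; x \<in> carrier M \<rbrakk> \<Longrightarrow> a \<odot>\<^bsub>M\<^esub> x \<in> carrier M"
    and smult_l_distr:
      "\<lbrakk> a \<in> carrier L; b \<in> carrier L; x \<in> carrier M \<rbrakk> \<Longrightarrow>
        (a \<oplus> b) \<odot>\<^bsub>M\<^esub> x = a \<odot>\<^bsub>M\<^esub> x \<oplus>\<^bsub>M\<^esub> b \<odot>\<^bsub>M\<^esub> x"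
    and smult_r_distr:
      "\<lbrakk> a \<in> carrier L; x \<in> carrier M; y \<in> carrier M \<rbrakk> \<Longrightarrow>
        a \<odot>\<^bsub>M\<^esub> (x \<oplus>\<^bsub>M\<^esub> y) = a \<odot>\<^bsub>M\<^esub> x \<oplus>\<^bsub>M\<^esub> a \<odot>\<^bsub>M\<^esub> y"
    and smult_assoc1:
      "\<lbrakk> a \<in> carrier L; b \<in> carrier L; x \<in> carrier M \<rbrakk> \<Longrightarrow>
        (a \<otimes> b) \<odot>\<^bsub>M\<^esub> x = a \<odot>\<^bsub>M\<^esub> (b \<odot>\<^bsub>M\<^esub> x)"
    and smult_one [simp]:
      "x \<in> carrier M \<Longrightarrow> \<one> \<odot>\<^bsub>M\<^esub> x = x"

definition opposite :: "('l, 'm) ring_scheme \<Rightarrow> 'l ring" where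
  "opposite L = \<lparr>carrier = carrier L, mult = (\<lambda>a b. b \<otimes>\<^bsub>L\<^esub> a), one = \<one>\<^bsub>L\<^esub>,
     zero = \<zero>\<^bsub>L\<^esub>, add = add L\<rparr>"

lemma opposite_ring: "ring L \<Longrightarrow> ring (opposite L)"
proof -
  assume "ring L" then interpret ring L .
  show ?thesis
  proof (rule ringI)
    show "abelian_group (opposite L)"
    proof (rule abelian_groupI)
      fix x assume "x \<in> carrier (opposite L)"
      then show "\<exists>y\<in>carrier (opposite L). y \<oplus>\<^bsub>opposite L\<^esub> x = \<zero>\<^bsub>opposite L\<^esub>"
        by (intro bexI[of _ "\<ominus>\<^bsub>L\<^esub> x"]) (simp_all add: opposite_def l_neg)
    qed (simp_all add: opposite_def a_ac)
    show "monoid (opposite L)"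
      by (rule monoidI) (auto simp: opposite_def m_assoc)
  qed (auto simp: opposite_def l_distr r_distr)
qed

definition regular_module :: "('l, 'm) ring_scheme \<Rightarrow> ('l, 'l) module" where
  "regular_module L = \<lparr>carrier = carrier L, mult = mult L, one = \<one>\<^bsub>L\<^esub>,
     zero = \<zero>\<^bsub>L\<^esub>, add = add L, smult = mult L\<rparr>"

definition zero_module :: "('l, unit) module" where
  "zero_module = \<lparr>carrier = {()}, mult = (\<lambda>_ _. ()), one = (), zero = (),
     add = (\<lambda>_ _. ()), smult = (\<lambda>_ _. ())\<rparr>"

definition restrict_scalars :: "('r \<Rightarrow> 'l) \<Rightarrow> ('l, 'a) module \<Rightarrow> ('r, 'a) module" where
  "restrict_scalars \<phi> M = \<lparr>carrier = carrier M, mult = mult M, one = \<one>\<^bsub>M\<^esub>,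
     zero = \<zero>\<^bsub>M\<^esub>, add = add M, smult = (\<lambda>r x. \<phi> r \<odot>\<^bsub>M\<^esub> x)\<rparr>"

abbreviation sub_module :: "('l, 'a) module \<Rightarrow> 'a set \<Rightarrow> ('l, 'a) module" where
  "sub_module M N \<equiv> M\<lparr>carrier := N\<rparr>"

definition quotient_module :: "('l, 'a) module \<Rightarrow> 'a set \<Rightarrow> ('l, 'a set) module" where
  "quotient_module M N = \<lparr>carrier = a_rcosets\<^bsub>M\<^esub> N, mult = (\<lambda>_ _. N), one = N,
     zero = N, add = set_add M, smult = (\<lambda>l A. \<Union>x\<in>A. N +>\<^bsub>M\<^esub> (l \<odot>\<^bsub>M\<^esub> x))\<rparr>"

lemma quotient_module_smult:
  assumes "left_module L M" "submodule N L M" "l \<in> carrier L" "x \<in> carrier M"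
  shows "l \<odot>\<^bsub>quotient_module M N\<^esub> (N +>\<^bsub>M\<^esub> x) = N +>\<^bsub>M\<^esub> (l \<odot>\<^bsub>M\<^esub> x)"
proof -
  interpret left_module L M by fact
  interpret N: submodule N L M by fact
  interpret ad: abelian_subgroup N M
    by (rule abelian_subgroupI3) (auto simp: additive_subgroup_def N.subgroup_axioms M.abelian_group_axioms)
  have sub: "n \<in> N \<Longrightarrow> n \<in> carrier M" for n using N.subset by auto
  have "N +>\<^bsub>M\<^esub> (l \<odot>\<^bsub>M\<^esub> y) = N +>\<^bsub>M\<^esub> (l \<odot>\<^bsub>M\<^esub> x)" if y: "y \<in> N +>\<^bsub>M\<^esub> x" for y
  proof -
    obtain n where n: "n \<in> N" "y = n \<oplus>\<^bsub>M\<^esub> x" using y by (auto simp: a_r_coset_def')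
    have "l \<odot>\<^bsub>M\<^esub> y = l \<odot>\<^bsub>M\<^esub> n \<oplus>\<^bsub>M\<^esub> l \<odot>\<^bsub>M\<^esub> x" using n assms sub by (simp add: smult_r_distr)
    then have "l \<odot>\<^bsub>M\<^esub> y \<in> N +>\<^bsub>M\<^esub> (l \<odot>\<^bsub>M\<^esub> x)"
      using N.smult_closed[OF assms(3) n(1)] unfolding a_r_coset_def' by blast
    then show ?thesis
      by (rule ad.a_repr_independence'[symmetric]) (simp add: assms)
  qed
  moreover have "x \<in> N +>\<^bsub>M\<^esub> x" by (rule ad.a_rcos_self) fact
  ultimately have "(\<Union>y\<in>N +>\<^bsub>M\<^esub> x. N +>\<^bsub>M\<^esub> (l \<odot>\<^bsub>M\<^esub> y)) = N +>\<^bsub>M\<^esub> (l \<odot>\<^bsub>M\<^esub> x)"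
    by blast
  then show ?thesis by (simp add: quotient_module_def)
qed

definition fin_gen :: "('l, 'm) ring_scheme \<Rightarrow> ('l, 'a) module \<Rightarrow> bool" where
  "fin_gen L M \<longleftrightarrow> (\<exists>S. finite S \<and> S \<subseteq> carrier M \<and>
     (\<forall>N. submodule N L M \<and> S \<subseteq> N \<longrightarrow> N = carrier M))"

definition fg_module :: "('l, 'm) ring_scheme \<Rightarrow> ('l, 'a) module \<Rightarrow> bool" where
  "fg_module L M \<longleftrightarrow> left_module L M \<and> fin_gen L M"

text \<open>Values of homomorphisms outside the carrier are irrelevant, as for \<^const>\<open>hom\<close>.\<close>

definition mod_hom ::
    "('l, 'm) ring_scheme \<Rightarrow> ('l, 'a) module \<Rightarrow> ('l, 'b) module \<Rightarrow> ('a \<Rightarrow> 'b) set" where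
  "mod_hom L M N = {f \<in> carrier M \<rightarrow> carrier N.
     (\<forall>x\<in>carrier M. \<forall>y\<in>carrier M. f (x \<oplus>\<^bsub>M\<^esub> y) = f x \<oplus>\<^bsub>N\<^esub> f y) \<and>
     (\<forall>l\<in>carrier L. \<forall>x\<in>carrier M. f (l \<odot>\<^bsub>M\<^esub> x) = l \<odot>\<^bsub>N\<^esub> f x)}"


section \<open>Artin algebras and the standard duality\<close>

text \<open>\<open>L\<close> is an algebra over the commutative artinian ring \<open>R\<close> through the structure map \<open>\<phi>\<close>.\<close>

locale artin_algebra = R?: cring R + L?: ring L for R (structure) and L (structure) +
  fixes \<phi> :: "'r \<Rightarrow> 'l"
  assumes artinian:
      "\<And>I :: nat \<Rightarrow> 'r set. \<lbrakk> \<And>n. ideal (I n) R; \<And>n. I (Suc n) \<subseteq> I n \<rbrakk> \<Longrightarrow>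
        \<exists>n. \<forall>m\<ge>n. I m = I n"
    and structure_map: "\<phi> \<in> ring_hom R L"
    and central: "\<lbrakk> r \<in> carrier R; l \<in> carrier L \<rbrakk> \<Longrightarrow> \<phi> r \<otimes>\<^bsub>L\<^esub> l = l \<otimes>\<^bsub>L\<^esub> \<phi> r"
    and finite_over_base: "fin_gen R (restrict_scalars \<phi> (regular_module L))"

text \<open>
  A definition cannot quantify over types, so the test modules have elements of the type of \<open>R\<close>.
  The regular module and its ideals are among them; by Baer's criterion this is no restriction.
\<close>

definition injective_module :: "('r, 'm) ring_scheme \<Rightarrow> ('r, 'j) module \<Rightarrow> bool" where
  "injective_module R J \<longleftrightarrow> module R J \<and>
     (\<forall>(M :: ('r, 'r) module) (N :: ('r, 'r) module) i f.
        module R M \<and> module R N \<and> i \<in> mod_hom R M N \<and> inj_on i (carrier M) \<and> f \<in> mod_hom R M J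
        \<longrightarrow> (\<exists>h \<in> mod_hom R N J. \<forall>x\<in>carrier M. h (i x) = f x))"

definition injective_envelope ::
    "('r, 'm) ring_scheme \<Rightarrow> ('r, 'a) module \<Rightarrow> ('r, 'j) module \<Rightarrow> bool" where
  "injective_envelope R M J \<longleftrightarrow> injective_module R J \<and>
     (\<exists>\<iota> \<in> mod_hom R M J. inj_on \<iota> (carrier M) \<and>
        (\<forall>N. submodule N R J \<and> N \<inter> \<iota> ` carrier M = {\<zero>\<^bsub>J\<^esub>} \<longrightarrow> N = {\<zero>\<^bsub>J\<^esub>}))"

definition jacobson_radical :: "('r, 'm) ring_scheme \<Rightarrow> 'r set" where
  "jacobson_radical R = {x \<in> carrier R. \<forall>I. maximalideal I R \<longrightarrow> x \<in> I}"

text \<open>The module defining the standard duality \<open>D = Hom\<^sub>R(-, J)\<close>: an injective envelope of \<open>R / rad R\<close>.\<close>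

definition dualizing_module :: "('r, 'm) ring_scheme \<Rightarrow> ('r, 'j) module \<Rightarrow> bool" where
  "dualizing_module R J \<longleftrightarrow>
     injective_envelope R (quotient_module (regular_module R) (jacobson_radical R)) J"

text \<open>
  Elements of Hom modules are extensional functions. The module \<open>D M\<close> is over the opposite of the
  ring acting on \<open>M\<close>, with \<open>(l f)(x) = f (l x)\<close>; the same formula covers left and right modules.
\<close>

definition D_obj ::
    "('r, 'm) ring_scheme \<Rightarrow> ('r \<Rightarrow> 'l) \<Rightarrow> ('r, 'j) module \<Rightarrow> ('l, 'a) module \<Rightarrow> ('l, 'a \<Rightarrow> 'j) module" where
  "D_obj R \<phi> J M =
     \<lparr>carrier = mod_hom R (restrict_scalars \<phi> M) J \<inter> extensional (carrier M),
      mult = (\<lambda>_ _. \<lambda>x\<in>carrier M. \<zero>\<^bsub>J\<^esub>), one = (\<lambda>x\<in>carrier M. \<zero>\<^bsub>J\<^esub>),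
      zero = (\<lambda>x\<in>carrier M. \<zero>\<^bsub>J\<^esub>),
      add = (\<lambda>f g. \<lambda>x\<in>carrier M. f x \<oplus>\<^bsub>J\<^esub> g x),
      smult = (\<lambda>l f. \<lambda>x\<in>carrier M. f (l \<odot>\<^bsub>M\<^esub> x))\<rparr>"

lemma D_obj_module:
  assumes A: "artin_algebra R L \<phi>" and J: "module R J" and M: "left_module L M"
  shows "left_module (opposite L) (D_obj R \<phi> J M)"
proof -
  interpret A: artin_algebra R L \<phi> by fact
  interpret left_module L M by fact
  interpret J: module R J by fact
  have ph: "\<phi> r \<in> carrier L" if "r \<in> carrier R" for r using A.structure_map that by (auto simp: ring_hom_def)
  have ce: "l \<odot>\<^bsub>M\<^esub> (\<phi> r \<odot>\<^bsub>M\<^esub> x) = \<phi> r \<odot>\<^bsub>M\<^esub> (l \<odot>\<^bsub>M\<^esub> x)" if "r \<in> carrier R" "l \<in> carrier L" "x \<in> carrier M" for r l x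
    using that ph by (simp add: smult_assoc1[symmetric] A.central)
  note d = D_obj_def mod_hom_def restrict_scalars_def
  have ag: "abelian_group (D_obj R \<phi> J M)"
  proof (rule abelian_groupI)
    fix x y z assume "x \<in> carrier (D_obj R \<phi> J M)" "y \<in> carrier (D_obj R \<phi> J M)" "z \<in> carrier (D_obj R \<phi> J M)"
    then show "x \<oplus>\<^bsub>D_obj R \<phi> J M\<^esub> y \<oplus>\<^bsub>D_obj R \<phi> J M\<^esub> z = x \<oplus>\<^bsub>D_obj R \<phi> J M\<^esub> (y \<oplus>\<^bsub>D_obj R \<phi> J M\<^esub> z)"
      by (intro ext) (auto simp: d J.a_assoc Pi_iff)
  next
    fix x assume "x \<in> carrier (D_obj R \<phi> J M)"
    then show "\<exists>y\<in>carrier (D_obj R \<phi> J M). y \<oplus>\<^bsub>D_obj R \<phi> J M\<^esub> x = \<zero>\<^bsub>D_obj R \<phi> J M\<^esub>"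
      by (intro bexI[of _ "\<lambda>a\<in>carrier M. \<ominus>\<^bsub>J\<^esub> x a"])
        (auto simp: d Pi_iff J.M.l_neg J.M.minus_add J.smult_r_minus ph)
  next
    fix x assume "x \<in> carrier (D_obj R \<phi> J M)"
    then show "\<zero>\<^bsub>D_obj R \<phi> J M\<^esub> \<oplus>\<^bsub>D_obj R \<phi> J M\<^esub> x = x"
      by (intro ext) (auto simp: d Pi_iff extensional_def)
  qed (auto simp: d Pi_iff J.a_ac J.smult_r_distr ph)
  show ?thesis
    apply (rule left_module.intro)
      apply (rule opposite_ring, rule left_module.axioms(1)[OF M])
     apply (rule ag)
    apply unfold_locales
    by (auto simp: d Pi_iff opposite_def smult_assoc1 smult_l_distr smult_r_distr ph ce
        intro!: restrict_ext extensionalityI[of _ "carrier M"])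
qed

text \<open>\<open>Hom\<^sub>L(M, L)\<close> as a right module, \<open>(f l)(x) = f(x) l\<close>.\<close>

definition star_obj :: "('l, 'm) ring_scheme \<Rightarrow> ('l, 'a) module \<Rightarrow> ('l, 'a \<Rightarrow> 'l) module" where
  "star_obj L M =
     \<lparr>carrier = mod_hom L M (regular_module L) \<inter> extensional (carrier M),
      mult = (\<lambda>_ _. \<lambda>x\<in>carrier M. \<zero>\<^bsub>L\<^esub>), one = (\<lambda>x\<in>carrier M. \<zero>\<^bsub>L\<^esub>),
      zero = (\<lambda>x\<in>carrier M. \<zero>\<^bsub>L\<^esub>),
      add = (\<lambda>f g. \<lambda>x\<in>carrier M. f x \<oplus>\<^bsub>L\<^esub> g x),
      smult = (\<lambda>l f. \<lambda>x\<in>carrier M. f x \<otimes>\<^bsub>L\<^esub> l)\<rparr>"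

lemma star_obj_module:
  assumes "left_module L M"
  shows "left_module (opposite L) (star_obj L M)"
proof -
  interpret left_module L M by fact
  have ag: "abelian_group (star_obj L M)"
  proof (rule abelian_groupI)
    fix x y z assume "x \<in> carrier (star_obj L M)" "y \<in> carrier (star_obj L M)" "z \<in> carrier (star_obj L M)"
    then show "x \<oplus>\<^bsub>star_obj L M\<^esub> y \<oplus>\<^bsub>star_obj L M\<^esub> z = x \<oplus>\<^bsub>star_obj L M\<^esub> (y \<oplus>\<^bsub>star_obj L M\<^esub> z)"
      by (intro ext) (auto simp: star_obj_def mod_hom_def regular_module_def L.a_assoc Pi_iff)
  next
    fix x assume "x \<in> carrier (star_obj L M)"
    then show "\<exists>y\<in>carrier (star_obj L M). y \<oplus>\<^bsub>star_obj L M\<^esub> x = \<zero>\<^bsub>star_obj L M\<^esub>"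
      by (intro bexI[of _ "\<lambda>a\<in>carrier M. \<ominus>\<^bsub>L\<^esub> x a"])
        (auto simp: star_obj_def mod_hom_def regular_module_def Pi_iff L.l_neg L.minus_add L.r_minus)
  next
    fix x assume "x \<in> carrier (star_obj L M)"
    then show "\<zero>\<^bsub>star_obj L M\<^esub> \<oplus>\<^bsub>star_obj L M\<^esub> x = x"
      by (intro ext) (auto simp: star_obj_def mod_hom_def regular_module_def Pi_iff extensional_def)
  qed (auto simp: star_obj_def mod_hom_def regular_module_def Pi_iff L.a_ac L.r_distr)
  show ?thesis
    apply (rule left_module.intro)
      apply (rule opposite_ring, rule L.ring_axioms)
     apply (rule ag)
    apply unfold_locales
    by (auto simp: star_obj_def mod_hom_def regular_module_def Pi_iff opposite_def L.m_assoc L.r_distr L.l_distr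
        intro!: restrict_ext extensionalityI[of _ "carrier M"])
qed

text \<open>The action on a map \<open>f\<close> with domain \<open>M\<close> of either contravariant Hom functor.\<close>

definition precomp :: "('l, 'a) module \<Rightarrow> ('a \<Rightarrow> 'b) \<Rightarrow> ('b \<Rightarrow> 'c) \<Rightarrow> 'a \<Rightarrow> 'c" where
  "precomp M f = (\<lambda>g. compose (carrier M) g f)"

definition nakayama_obj ::
    "('r, 'm) ring_scheme \<Rightarrow> ('r \<Rightarrow> 'l) \<Rightarrow> ('r, 'j) module \<Rightarrow> ('l, 'n) ring_scheme \<Rightarrow>
     ('l, 'a) module \<Rightarrow> ('l, ('a \<Rightarrow> 'l) \<Rightarrow> 'j) module" where
  "nakayama_obj R \<phi> J L M = D_obj R \<phi> J (star_obj L M)"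

definition nakayama_map ::
    "('l, 'n) ring_scheme \<Rightarrow> ('l, 'a) module \<Rightarrow> ('l, 'b) module \<Rightarrow> ('a \<Rightarrow> 'b) \<Rightarrow>
     (('a \<Rightarrow> 'l) \<Rightarrow> 'j) \<Rightarrow> ('b \<Rightarrow> 'l) \<Rightarrow> 'j" where
  "nakayama_map L M N f = precomp (star_obj L N) (precomp M f)"


section \<open>Minimal projective presentations of modules\<close>

text \<open>
  Every finitely generated module is isomorphic to a quotient of some \<open>L\<^sup>n\<close>, hence to a
  module with elements of type \<open>(nat \<Rightarrow> 'l) set\<close>, so testing on that type is no restriction.
\<close>

definition projective_module :: "('l, 'm) ring_scheme \<Rightarrow> ('l, 'a) module \<Rightarrow> bool" where
  "projective_module L P \<longleftrightarrow> fg_module L P \<and>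
     (\<forall>(M :: ('l, (nat \<Rightarrow> 'l) set) module) (N :: ('l, (nat \<Rightarrow> 'l) set) module) p f.
        fg_module L M \<and> fg_module L N \<and> p \<in> mod_hom L M N \<and> p ` carrier M = carrier N \<and>
        f \<in> mod_hom L P N
        \<longrightarrow> (\<exists>h \<in> mod_hom L P M. \<forall>x\<in>carrier P. p (h x) = f x))"

definition projective_cover ::
    "('l, 'm) ring_scheme \<Rightarrow> ('l, 'a) module \<Rightarrow> ('a \<Rightarrow> 'b) \<Rightarrow> ('l, 'b) module \<Rightarrow> bool" where
  "projective_cover L P p M \<longleftrightarrow>
     projective_module L P \<and> p \<in> mod_hom L P M \<and> p ` carrier P = carrier M \<and>
     (\<forall>N. submodule N L P \<and> p ` N = carrier M \<longrightarrow> N = carrier P)"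

definition minimal_projective_presentation ::
    "('l, 'm) ring_scheme \<Rightarrow> ('l, 'a) module \<Rightarrow> ('a \<Rightarrow> 'b) \<Rightarrow> ('l, 'b) module \<Rightarrow> ('b \<Rightarrow> 'c) \<Rightarrow>
     ('l, 'c) module \<Rightarrow> bool" where
  "minimal_projective_presentation L P1 \<alpha> P0 \<pi> C \<longleftrightarrow>
     projective_cover L P0 \<pi> C \<and>
     projective_cover L P1 \<alpha> (sub_module P0 (a_kernel P0 C \<pi>))"


section \<open>The morphism category\<close>

record ('l, 'a, 'b) mor_obj =
  src :: "('l, 'a) module"
  tgt :: "('l, 'b) module"
  arr :: "'a \<Rightarrow> 'b"

definition H_obj :: "('l, 'm) ring_scheme \<Rightarrow> ('l, 'a, 'b) mor_obj \<Rightarrow> bool" where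
  "H_obj L X \<longleftrightarrow> fg_module L (src X) \<and> fg_module L (tgt X) \<and> arr X \<in> mod_hom L (src X) (tgt X)"

definition H_hom ::
    "('l, 'm) ring_scheme \<Rightarrow> ('l, 'a, 'b) mor_obj \<Rightarrow> ('l, 'c, 'd) mor_obj \<Rightarrow>
     (('a \<Rightarrow> 'c) \<times> ('b \<Rightarrow> 'd)) set" where
  "H_hom L X Y = {(h1, h2). h1 \<in> mod_hom L (src X) (src Y) \<and> h2 \<in> mod_hom L (tgt X) (tgt Y) \<and>
     (\<forall>x\<in>carrier (src X). arr Y (h1 x) = h2 (arr X x))}"

definition H_iso ::
    "('l, 'm) ring_scheme \<Rightarrow> ('l, 'a, 'b) mor_obj \<Rightarrow> ('l, 'c, 'd) mor_obj \<Rightarrow> bool" where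
  "H_iso L X Y \<longleftrightarrow> (\<exists>(h1, h2) \<in> H_hom L X Y.
     bij_betw h1 (carrier (src X)) (carrier (src Y)) \<and>
     bij_betw h2 (carrier (tgt X)) (carrier (tgt Y)))"

definition H_epi :: "('l, 'm) ring_scheme \<Rightarrow> ('l, 'a, 'b) mor_obj \<Rightarrow> ('a \<Rightarrow> 'c) \<times> ('b \<Rightarrow> 'd) \<Rightarrow>
    ('l, 'c, 'd) mor_obj \<Rightarrow> bool" where
  "H_epi L X h Y \<longleftrightarrow> h \<in> H_hom L X Y \<and>
     fst h ` carrier (src X) = carrier (src Y) \<and> snd h ` carrier (tgt X) = carrier (tgt Y)"

definition H_sub :: "('l, 'a, 'b) mor_obj \<Rightarrow> 'a set \<Rightarrow> 'b set \<Rightarrow> ('l, 'a, 'b) mor_obj" where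
  "H_sub X A B = \<lparr>src = sub_module (src X) A, tgt = sub_module (tgt X) B, arr = arr X\<rparr>"

definition H_subobject ::
    "('l, 'm) ring_scheme \<Rightarrow> ('l, 'a, 'b) mor_obj \<Rightarrow> 'a set \<Rightarrow> 'b set \<Rightarrow> bool" where
  "H_subobject L X A B \<longleftrightarrow> submodule A L (src X) \<and> submodule B L (tgt X) \<and> arr X ` A \<subseteq> B"

definition H_kernel ::
    "('l, 'a, 'b) mor_obj \<Rightarrow> ('a \<Rightarrow> 'c) \<times> ('b \<Rightarrow> 'd) \<Rightarrow> ('l, 'c, 'd) mor_obj \<Rightarrow> ('l, 'a, 'b) mor_obj" where
  "H_kernel X h Y =
     H_sub X (a_kernel (src X) (src Y) (fst h)) (a_kernel (tgt X) (tgt Y) (snd h))"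

text \<open>The arrow of the cokernel sends the coset of \<open>y\<close> to the coset of \<open>arr Y y\<close>.\<close>

definition H_coker ::
    "('l, 'a, 'b) mor_obj \<Rightarrow> ('a \<Rightarrow> 'c) \<times> ('b \<Rightarrow> 'd) \<Rightarrow> ('l, 'c, 'd) mor_obj \<Rightarrow>
     ('l, 'c set, 'd set) mor_obj" where
  "H_coker X h Y =
     \<lparr>src = quotient_module (src Y) (fst h ` carrier (src X)),
      tgt = quotient_module (tgt Y) (snd h ` carrier (tgt X)),
      arr = (\<lambda>A. \<Union>y\<in>A. (snd h ` carrier (tgt X)) +>\<^bsub>tgt Y\<^esub> arr Y y)\<rparr>"

text \<open>The choice of test objects is justified as for \<^const>\<open>projective_module\<close>.\<close>

definition H_projective :: "('l, 'm) ring_scheme \<Rightarrow> ('l, 'a, 'b) mor_obj \<Rightarrow> bool" where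
  "H_projective L P \<longleftrightarrow> H_obj L P \<and>
     (\<forall>(M :: ('l, (nat \<Rightarrow> 'l) set, (nat \<Rightarrow> 'l) set) mor_obj)
       (N :: ('l, (nat \<Rightarrow> 'l) set, (nat \<Rightarrow> 'l) set) mor_obj) p f.
        H_obj L M \<and> H_obj L N \<and> H_epi L M p N \<and> f \<in> H_hom L P N
        \<longrightarrow> (\<exists>h \<in> H_hom L P M.
              (\<forall>x\<in>carrier (src P). fst p (fst h x) = fst f x) \<and>
              (\<forall>y\<in>carrier (tgt P). snd p (snd h y) = snd f y)))"

definition H_projective_cover ::
    "('l, 'm) ring_scheme \<Rightarrow> ('l, 'a, 'b) mor_obj \<Rightarrow> ('a \<Rightarrow> 'c) \<times> ('b \<Rightarrow> 'd) \<Rightarrow>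
     ('l, 'c, 'd) mor_obj \<Rightarrow> bool" where
  "H_projective_cover L P p X \<longleftrightarrow> H_projective L P \<and> H_epi L P p X \<and>
     (\<forall>A B. H_subobject L P A B \<and> fst p ` A = carrier (src X) \<and> snd p ` B = carrier (tgt X)
        \<longrightarrow> A = carrier (src P) \<and> B = carrier (tgt P))"

definition H_minimal_projective_presentation ::
    "('l, 'm) ring_scheme \<Rightarrow> ('l, 'a, 'b) mor_obj \<Rightarrow> ('a \<Rightarrow> 'c) \<times> ('b \<Rightarrow> 'd) \<Rightarrow>
     ('l, 'c, 'd) mor_obj \<Rightarrow> ('c \<Rightarrow> 'e) \<times> ('d \<Rightarrow> 'f) \<Rightarrow> ('l, 'e, 'f) mor_obj \<Rightarrow> bool" where
  "H_minimal_projective_presentation L P1 g P0 p X \<longleftrightarrow>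
     H_projective_cover L P0 p X \<and> H_projective_cover L P1 g (H_kernel P0 p X)"


section \<open>The Auslander-Reiten translation of the morphism category\<close>

text \<open>\<open>X = (A \<rightarrow> B)\<close> with map \<open>f\<close> goes to the inclusion of \<open>Ker(f\<^sup>*)\<close> into \<open>B\<^sup>*\<close>.\<close>

definition H_star ::
    "('l, 'm) ring_scheme \<Rightarrow> ('l, 'a, 'b) mor_obj \<Rightarrow> ('l, 'b \<Rightarrow> 'l, 'b \<Rightarrow> 'l) mor_obj" where
  "H_star L X =
     \<lparr>src = sub_module (star_obj L (tgt X))
              (a_kernel (star_obj L (tgt X)) (star_obj L (src X)) (precomp (src X) (arr X))),
      tgt = star_obj L (tgt X),
      arr = (\<lambda>u. u)\<rparr>"

text \<open>
  On a morphism \<open>(h1, h2)\<close> from \<open>X\<close> to \<open>Y\<close>, both components are given by precomposition with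
  \<open>h2\<close>, the first one being the restriction to the kernels.
\<close>

definition H_star_map ::
    "('l, 'a, 'b) mor_obj \<Rightarrow> ('a \<Rightarrow> 'c) \<times> ('b \<Rightarrow> 'd) \<Rightarrow>
     (('d \<Rightarrow> 'l) \<Rightarrow> 'b \<Rightarrow> 'l) \<times> (('d \<Rightarrow> 'l) \<Rightarrow> 'b \<Rightarrow> 'l)" where
  "H_star_map X h = (precomp (tgt X) (snd h), precomp (tgt X) (snd h))"

definition H_D ::
    "('r, 'm) ring_scheme \<Rightarrow> ('r \<Rightarrow> 'l) \<Rightarrow> ('r, 'j) module \<Rightarrow> ('l, 'a, 'b) mor_obj \<Rightarrow>
     ('l, 'b \<Rightarrow> 'j, 'a \<Rightarrow> 'j) mor_obj" where
  "H_D R \<phi> J X =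
     \<lparr>src = D_obj R \<phi> J (tgt X), tgt = D_obj R \<phi> J (src X), arr = precomp (src X) (arr X)\<rparr>"

text \<open>
  The translate is only defined up to isomorphism, through a minimal projective presentation of
  the object; \<open>g\<close> from \<open>P1\<close> to \<open>P0\<close> is the first map of that presentation.
\<close>

definition AR_translate ::
    "('r, 'm) ring_scheme \<Rightarrow> ('r \<Rightarrow> 'l) \<Rightarrow> ('r, 'j) module \<Rightarrow> ('l, 'n) ring_scheme \<Rightarrow>
     ('l, 'a, 'b) mor_obj \<Rightarrow> ('a \<Rightarrow> 'c) \<times> ('b \<Rightarrow> 'd) \<Rightarrow> ('l, 'c, 'd) mor_obj \<Rightarrow>
     ('l, ('b \<Rightarrow> 'l) set \<Rightarrow> 'j, ('b \<Rightarrow> 'l) set \<Rightarrow> 'j) mor_obj" where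
  "AR_translate R \<phi> J L P1 g P0 =
     H_D R \<phi> J (H_coker (H_star L P0) (H_star_map P1 g) (H_star L P1))"

definition to_zero :: "('l, 'a) module \<Rightarrow> ('l, 'a, unit) mor_obj" where
  "to_zero C = \<lparr>src = C, tgt = zero_module, arr = (\<lambda>_. ())\<rparr>"

definition nakayama_mor ::
    "('r, 'm) ring_scheme \<Rightarrow> ('r \<Rightarrow> 'l) \<Rightarrow> ('r, 'j) module \<Rightarrow> ('l, 'n) ring_scheme \<Rightarrow>
     ('l, 'a) module \<Rightarrow> ('a \<Rightarrow> 'b) \<Rightarrow> ('l, 'b) module \<Rightarrow>
     ('l, ('a \<Rightarrow> 'l) \<Rightarrow> 'j, ('b \<Rightarrow> 'l) \<Rightarrow> 'j) mor_obj" where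
  "nakayama_mor R \<phi> J L P1 \<alpha> P0 =
     \<lparr>src = nakayama_obj R \<phi> J L P1, tgt = nakayama_obj R \<phi> J L P0,
      arr = nakayama_map L P1 P0 \<alpha>\<rparr>"

end

theory Submission
  imports Defs
begin

text \<open>
  A minimal presentation in \<open>\<H>\<close> is compared with the following explicit one, which only
  involves the presentation of \<open>C\<close>. The cover of \<open>(C \<rightarrow> 0)\<close> is \<open>(P\<^sub>0 = P\<^sub>0)\<close>, with kernel
  \<open>(Ker \<pi> \<rightarrow> P\<^sub>0)\<close>, and the cover of the latter is \<open>(P\<^sub>1 \<rightarrow> P\<^sub>1 \<oplus> P\<^sub>0)\<close>, mapping by \<open>\<alpha>\<close> and
  \<open>(\<alpha>, 1)\<close>. Each explicit object maps onto the given one because the latter is minimal; that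
  epimorphism splits because the given object is projective, and its section is onto because the
  covers \<open>P\<^sub>0\<close> and \<open>P\<^sub>1\<close> are minimal.

  Dualizing, the two objects become \<open>(0 \<rightarrow> P\<^sub>0\<^sup>*)\<close> and \<open>(P\<^sub>0\<^sup>* \<rightarrow> P\<^sub>1\<^sup>* \<oplus> P\<^sub>0\<^sup>*)\<close>. The cokernel of
  \<open>(\<alpha>\<^sup>*, 1)\<close> from \<open>P\<^sub>0\<^sup>*\<close> to \<open>P\<^sub>1\<^sup>* \<oplus> P\<^sub>0\<^sup>*\<close> is \<open>P\<^sub>1\<^sup>*\<close>, and the induced arrow from \<open>P\<^sub>0\<^sup>*\<close> to \<open>P\<^sub>1\<^sup>*\<close>
  is \<open>-\<alpha>\<^sup>*\<close>. Applying \<open>D\<close> gives \<open>\<nu>(\<alpha>)\<close> up to sign.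
\<close>

section \<open>Modules and homomorphisms\<close>

lemma mod_homI:
  assumes "\<And>x. x \<in> carrier M \<Longrightarrow> f x \<in> carrier N"
    and "\<And>x y. \<lbrakk>x \<in> carrier M; y \<in> carrier M\<rbrakk> \<Longrightarrow> f (x \<oplus>\<^bsub>M\<^esub> y) = f x \<oplus>\<^bsub>N\<^esub> f y"
    and "\<And>l x. \<lbrakk>l \<in> carrier L; x \<in> carrier M\<rbrakk> \<Longrightarrow> f (l \<odot>\<^bsub>M\<^esub> x) = l \<odot>\<^bsub>N\<^esub> f x"
  shows "f \<in> mod_hom L M N"
  using assms by (auto simp: mod_hom_def)

lemma mod_homD:
  assumes "f \<in> mod_hom L M N"
  shows mod_hom_closed: "x \<in> carrier M \<Longrightarrow> f x \<in> carrier N"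
    and mod_hom_add: "\<lbrakk>x \<in> carrier M; y \<in> carrier M\<rbrakk> \<Longrightarrow> f (x \<oplus>\<^bsub>M\<^esub> y) = f x \<oplus>\<^bsub>N\<^esub> f y"
    and mod_hom_smult: "\<lbrakk>l \<in> carrier L; x \<in> carrier M\<rbrakk> \<Longrightarrow> f (l \<odot>\<^bsub>M\<^esub> x) = l \<odot>\<^bsub>N\<^esub> f x"
  using assms by (auto simp: mod_hom_def)

lemma mod_hom_id: "(\<lambda>x. x) \<in> mod_hom L M M"
  by (auto simp: mod_hom_def)

lemma mod_hom_comp:
  assumes "f \<in> mod_hom L M N" "g \<in> mod_hom L N K"
  shows "(\<lambda>x. g (f x)) \<in> mod_hom L M K"
  using assms by (intro mod_homI) (simp_all add: mod_homD[OF assms(1)] mod_homD[OF assms(2)])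

lemma mod_hom_inv_into:
  assumes M: "left_module L M" and f: "f \<in> mod_hom L M N" "bij_betw f (carrier M) (carrier N)"
  shows "inv_into (carrier M) f \<in> mod_hom L N M"
proof -
  interpret left_module L M by fact
  let ?g = "inv_into (carrier M) f"
  \<comment> \<open>Sums and multiples in \<open>N\<close> are read off from those in
    \<open>M\<close> through \<open>f\<close>, so the argument also covers a target known only by
    its operations, such as a quotient module.\<close>
  have c: "?g y \<in> carrier M" "f (?g y) = y" if "y \<in> carrier N" for y
    using that f(2) by (auto simp: bij_betw_def inv_into_into f_inv_into_f)
  have i: "?g (f x) = x" if "x \<in> carrier M" for x
    using that f(2) by (simp add: bij_betw_def inv_into_f_f)
  show ?thesis
  proof (rule mod_homI)
    fix x y assume "x \<in> carrier N" "y \<in> carrier N"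
    then show "?g (x \<oplus>\<^bsub>N\<^esub> y) = ?g x \<oplus>\<^bsub>M\<^esub> ?g y"
      using mod_hom_add[OF f(1) c(1) c(1), of x y] c i[of "?g x \<oplus>\<^bsub>M\<^esub> ?g y"] by simp
  next
    fix l x assume "l \<in> carrier L" "x \<in> carrier N"
    then show "?g (l \<odot>\<^bsub>N\<^esub> x) = l \<odot>\<^bsub>M\<^esub> ?g x"
      using mod_hom_smult[OF f(1) _ c(1), of l x] c i[of "l \<odot>\<^bsub>M\<^esub> ?g x"] by simp
  qed (simp add: c)
qed

lemma mod_hom_zero:
  assumes "left_module L M" "left_module L N" "f \<in> mod_hom L M N"
  shows "f \<zero>\<^bsub>M\<^esub> = \<zero>\<^bsub>N\<^esub>"
proof -
  interpret M: left_module L M by fact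
  interpret N: left_module L N by fact
  have "f \<zero>\<^bsub>M\<^esub> \<oplus>\<^bsub>N\<^esub> f \<zero>\<^bsub>M\<^esub> = f \<zero>\<^bsub>M\<^esub>"
    using mod_hom_add[OF assms(3), of "\<zero>\<^bsub>M\<^esub>" "\<zero>\<^bsub>M\<^esub>"] by simp
  then show ?thesis
    using mod_hom_closed[OF assms(3)] by (metis M.M.zero_closed N.M.add.r_cancel_one')
qed

section \<open>Scalar identities and submodules\<close>

context left_module
begin

lemma smult_l_null: "x \<in> carrier M \<Longrightarrow> \<zero> \<odot>\<^bsub>M\<^esub> x = \<zero>\<^bsub>M\<^esub>"
  using smult_l_distr[of \<zero> \<zero> x] by (simp add: M.add.r_cancel_one')

lemma smult_r_null: "a \<in> carrier L \<Longrightarrow> a \<odot>\<^bsub>M\<^esub> \<zero>\<^bsub>M\<^esub> = \<zero>\<^bsub>M\<^esub>"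
  using smult_r_distr[of a "\<zero>\<^bsub>M\<^esub>" "\<zero>\<^bsub>M\<^esub>"] by (simp add: M.add.r_cancel_one')

lemma smult_minus_one: "x \<in> carrier M \<Longrightarrow> (\<ominus> \<one>) \<odot>\<^bsub>M\<^esub> x = \<ominus>\<^bsub>M\<^esub> x"
  using smult_l_distr[of "\<ominus> \<one>" \<one> x] smult_l_null
  by (simp add: L.l_neg M.minus_equality)

lemma smult_r_minus:
  "\<lbrakk>a \<in> carrier L; x \<in> carrier M\<rbrakk> \<Longrightarrow> a \<odot>\<^bsub>M\<^esub> (\<ominus>\<^bsub>M\<^esub> x) = \<ominus>\<^bsub>M\<^esub> (a \<odot>\<^bsub>M\<^esub> x)"
  using smult_r_distr[of a "\<ominus>\<^bsub>M\<^esub> x" x] smult_r_null[of a]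
  by (simp add: M.l_neg M.minus_equality)

lemma submoduleI:
  assumes "H \<subseteq> carrier M" "\<zero>\<^bsub>M\<^esub> \<in> H"
    and "\<And>a b. \<lbrakk>a \<in> H; b \<in> H\<rbrakk> \<Longrightarrow> a \<oplus>\<^bsub>M\<^esub> b \<in> H"
    and sm: "\<And>a x. \<lbrakk>a \<in> carrier L; x \<in> H\<rbrakk> \<Longrightarrow> a \<odot>\<^bsub>M\<^esub> x \<in> H"
  shows "submodule H L M"
proof -
  \<comment> \<open>Negatives come from multiplication by \<open>\<ominus> \<one>\<close>.\<close>
  have "\<ominus>\<^bsub>M\<^esub> x \<in> H" if "x \<in> H" for x
    using sm[of "\<ominus> \<one>" x] that assms(1) by (auto simp: smult_minus_one subset_iff)
  then show ?thesis
    using assms by (auto simp: submodule_def submodule_axioms_def a_inv_def intro!: M.add.subgroupI)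
qed

lemma submodule_facts:
  assumes "submodule H L M"
  shows submodule_subset: "H \<subseteq> carrier M"
    and submodule_zero: "\<zero>\<^bsub>M\<^esub> \<in> H"
    and submodule_add: "\<And>a b. \<lbrakk>a \<in> H; b \<in> H\<rbrakk> \<Longrightarrow> a \<oplus>\<^bsub>M\<^esub> b \<in> H"
    and submodule_minus: "\<And>a. a \<in> H \<Longrightarrow> \<ominus>\<^bsub>M\<^esub> a \<in> H"
    and submodule_smult: "\<And>a x. \<lbrakk>a \<in> carrier L; x \<in> H\<rbrakk> \<Longrightarrow> a \<odot>\<^bsub>M\<^esub> x \<in> H"
proof -
  interpret H: submodule H L M by fact
  show "H \<subseteq> carrier M" using H.subset by simp
  show "\<zero>\<^bsub>M\<^esub> \<in> H" using H.one_closed by simp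
  show "\<And>a b. \<lbrakk>a \<in> H; b \<in> H\<rbrakk> \<Longrightarrow> a \<oplus>\<^bsub>M\<^esub> b \<in> H" using H.m_closed by simp
  show "\<And>a. a \<in> H \<Longrightarrow> \<ominus>\<^bsub>M\<^esub> a \<in> H" using H.m_inv_closed by (simp add: a_inv_def)
qed (rule submodule.smult_closed[OF assms])

lemma submodule_carrier: "submodule (carrier M) L M"
  by (rule submoduleI) auto

lemma submodule_zero_set: "submodule {\<zero>\<^bsub>M\<^esub>} L M"
  by (rule submoduleI) (auto simp: smult_r_null)

end

lemma left_module_sub_module:
  assumes "left_module L M" "submodule H L M"
  shows "left_module L (sub_module M H)"
proof -
  interpret left_module L M by fact
  note s = submodule_facts[OF assms(2)]
  have c: "x \<in> carrier M" if "x \<in> H" for x using that s(1) by auto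
  have ag: "abelian_group (sub_module M H)"
  proof (rule abelian_groupI)
    fix x assume "x \<in> carrier (sub_module M H)"
    then show "\<exists>y\<in>carrier (sub_module M H). y \<oplus>\<^bsub>sub_module M H\<^esub> x = \<zero>\<^bsub>sub_module M H\<^esub>"
      using s c by (intro bexI[of _ "\<ominus>\<^bsub>M\<^esub> x"]) (auto simp: M.l_neg)
  qed (auto simp: s c M.a_ac)
  show ?thesis
    apply (intro left_module.intro L.ring_axioms ag left_module_axioms.intro)
    by (auto simp: s c smult_l_distr smult_r_distr smult_assoc1)
qed

lemma submodule_image:
  assumes "left_module L M" "left_module L N" "f \<in> mod_hom L M N" "submodule H L M"
  shows "submodule (f ` H) L N"
proof -
  interpret M: left_module L M by fact
  interpret N: left_module L N by fact
  note s = M.submodule_facts[OF assms(4)]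
  have c: "x \<in> carrier M" if "x \<in> H" for x using that s(1) by auto
  show ?thesis
  proof (rule N.submoduleI)
    show "\<zero>\<^bsub>N\<^esub> \<in> f ` H"
      using mod_hom_zero[OF assms(1-3)] s(2) by (metis image_eqI)
  next
    fix a b assume "a \<in> f ` H" "b \<in> f ` H"
    then obtain x y where "a = f x" "b = f y" "x \<in> H" "y \<in> H" by blast
    then show "a \<oplus>\<^bsub>N\<^esub> b \<in> f ` H"
      using mod_hom_add[OF assms(3) c c] s(3) by (metis image_eqI)
  next
    fix l b assume l: "l \<in> carrier L" "b \<in> f ` H"
    then obtain y where "b = f y" "y \<in> H" by blast
    then show "l \<odot>\<^bsub>N\<^esub> b \<in> f ` H"
      using mod_hom_smult[OF assms(3) l(1) c] s(5) l(1) by (metis image_eqI)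
  qed (auto intro: mod_hom_closed[OF assms(3)] c)
qed

lemma submodule_vimage:
  assumes "left_module L M" "left_module L N" "f \<in> mod_hom L M N" "submodule H L N"
  shows "submodule {x \<in> carrier M. f x \<in> H} L M"
proof -
  interpret M: left_module L M by fact
  note s = left_module.submodule_facts[OF assms(2,4)]
  show ?thesis
    using mod_hom_zero[OF assms(1-3)] s
    by (intro M.submoduleI) (auto simp: mod_homD[OF assms(3)])
qed

lemma submodule_kernel:
  assumes "left_module L M" "left_module L N" "f \<in> mod_hom L M N"
  shows "submodule (a_kernel M N f) L M"
  using submodule_vimage[OF assms left_module.submodule_zero_set[OF assms(2)]]
  by (simp add: a_kernel_def')

text \<open>The images of generators generate: the preimage of a submodule containing them contains
  the generators of \<open>M\<close>, hence is all of \<open>M\<close>.\<close>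

lemma fg_module_surj:
  assumes "fg_module L M" "left_module L N" "f \<in> mod_hom L M N" "f ` carrier M = carrier N"
  shows "fg_module L N"
proof -
  interpret M: left_module L M using assms(1) by (simp add: fg_module_def)
  obtain S where S: "finite S" "S \<subseteq> carrier M"
    and g: "\<And>K. \<lbrakk>submodule K L M; S \<subseteq> K\<rbrakk> \<Longrightarrow> K = carrier M"
    using assms(1) by (auto simp: fg_module_def fin_gen_def)
  have "K = carrier N" if K: "submodule K L N" "f ` S \<subseteq> K" for K
  proof -
    have "{x \<in> carrier M. f x \<in> K} = carrier M"
      using K S by (intro g submodule_vimage[OF M.left_module_axioms assms(2,3)]) auto
    then show ?thesis
      using assms(4) left_module.submodule_subset[OF assms(2) K(1)]
      by (metis (mono_tags, lifting) image_subsetI mem_Collect_eq subset_antisym)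
  qed
  then show ?thesis
    using S assms(2,4) unfolding fg_module_def fin_gen_def by (metis finite_imageI image_mono)
qed

section \<open>Binary direct sums, for the target of the cover of the kernel object\<close>

definition prod_module :: "('l, 'a) module \<Rightarrow> ('l, 'b) module \<Rightarrow> ('l, 'a \<times> 'b) module" where
  "prod_module M N =
     \<lparr>carrier = carrier M \<times> carrier N, mult = (\<lambda>_ _. (\<zero>\<^bsub>M\<^esub>, \<zero>\<^bsub>N\<^esub>)), one = (\<zero>\<^bsub>M\<^esub>, \<zero>\<^bsub>N\<^esub>),
      zero = (\<zero>\<^bsub>M\<^esub>, \<zero>\<^bsub>N\<^esub>),
      add = (\<lambda>(a, b) (c, d). (a \<oplus>\<^bsub>M\<^esub> c, b \<oplus>\<^bsub>N\<^esub> d)),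
      smult = (\<lambda>l (a, b). (l \<odot>\<^bsub>M\<^esub> a, l \<odot>\<^bsub>N\<^esub> b))\<rparr>"

lemma prod_module_simps [simp]:
  "carrier (prod_module M N) = carrier M \<times> carrier N"
  "\<zero>\<^bsub>prod_module M N\<^esub> = (\<zero>\<^bsub>M\<^esub>, \<zero>\<^bsub>N\<^esub>)"
  "(a, b) \<oplus>\<^bsub>prod_module M N\<^esub> (c, d) = (a \<oplus>\<^bsub>M\<^esub> c, b \<oplus>\<^bsub>N\<^esub> d)"
  "l \<odot>\<^bsub>prod_module M N\<^esub> (a, b) = (l \<odot>\<^bsub>M\<^esub> a, l \<odot>\<^bsub>N\<^esub> b)"
  by (simp_all add: prod_module_def)

lemma left_module_prod:
  assumes "left_module L M" "left_module L N"
  shows "left_module L (prod_module M N)"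
proof -
  interpret M: left_module L M by fact
  interpret N: left_module L N by fact
  have ag: "abelian_group (prod_module M N)"
  proof (rule abelian_groupI)
    fix x assume "x \<in> carrier (prod_module M N)"
    then show "\<exists>y\<in>carrier (prod_module M N). y \<oplus>\<^bsub>prod_module M N\<^esub> x = \<zero>\<^bsub>prod_module M N\<^esub>"
      by (intro bexI[of _ "(\<ominus>\<^bsub>M\<^esub> fst x, \<ominus>\<^bsub>N\<^esub> snd x)"]) (auto simp: M.M.l_neg N.M.l_neg)
  qed (auto simp: M.M.a_ac N.M.a_ac)
  show ?thesis
    by (intro left_module.intro M.L.ring_axioms ag left_module_axioms.intro)
      (auto simp: M.smult_l_distr N.smult_l_distr M.smult_r_distr N.smult_r_distr M.smult_assoc1 N.smult_assoc1)
qed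

lemma mod_hom_prod:
  shows mod_hom_fst: "fst \<in> mod_hom L (prod_module M N) M"
    and mod_hom_snd: "snd \<in> mod_hom L (prod_module M N) N"
  by (auto simp: mod_hom_def)

lemma mod_hom_incl:
  assumes "left_module L M" "left_module L N"
  shows mod_hom_inl: "(\<lambda>x. (x, \<zero>\<^bsub>N\<^esub>)) \<in> mod_hom L M (prod_module M N)"
    and mod_hom_inr: "(\<lambda>y. (\<zero>\<^bsub>M\<^esub>, y)) \<in> mod_hom L N (prod_module M N)"
proof -
  interpret M: left_module L M by fact
  interpret N: left_module L N by fact
  show "(\<lambda>x. (x, \<zero>\<^bsub>N\<^esub>)) \<in> mod_hom L M (prod_module M N)"
    "(\<lambda>y. (\<zero>\<^bsub>M\<^esub>, y)) \<in> mod_hom L N (prod_module M N)"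
    by (auto intro!: mod_homI simp: M.smult_r_null N.smult_r_null)
qed

lemma mod_hom_copair:
  assumes "left_module L K" "f \<in> mod_hom L M K" "g \<in> mod_hom L N K"
  shows "(\<lambda>(x, y). f x \<oplus>\<^bsub>K\<^esub> g y) \<in> mod_hom L (prod_module M N) K"
proof -
  interpret K: left_module L K by fact
  show ?thesis
    by (rule mod_homI)
      (auto simp: mod_homD[OF assms(2)] mod_homD[OF assms(3)] K.M.a_ac K.smult_r_distr)
qed

text \<open>The preimages of a submodule under the two inclusions are submodules of the factors,
  which reduces generation of the product to generation of each factor.\<close>

lemma fg_module_prod:
  assumes "fg_module L M" "fg_module L N"
  shows "fg_module L (prod_module M N)"
proof -
  have mods: "left_module L M" "left_module L N" using assms by (auto simp: fg_module_def)
  interpret M: left_module L M by (rule mods)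
  interpret N: left_module L N by (rule mods)
  interpret MN: left_module L "prod_module M N" by (rule left_module_prod[OF mods])
  obtain S where S: "finite S" "S \<subseteq> carrier M"
    "\<And>K. \<lbrakk>submodule K L M; S \<subseteq> K\<rbrakk> \<Longrightarrow> K = carrier M"
    using assms(1) by (auto simp: fg_module_def fin_gen_def)
  obtain T where T: "finite T" "T \<subseteq> carrier N"
    "\<And>K. \<lbrakk>submodule K L N; T \<subseteq> K\<rbrakk> \<Longrightarrow> K = carrier N"
    using assms(2) by (auto simp: fg_module_def fin_gen_def)
  let ?U = "(\<lambda>x. (x, \<zero>\<^bsub>N\<^esub>)) ` S \<union> (\<lambda>y. (\<zero>\<^bsub>M\<^esub>, y)) ` T"
  have "K = carrier (prod_module M N)" if K: "submodule K L (prod_module M N)" "?U \<subseteq> K" for K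
  proof -
    have "{x \<in> carrier M. (x, \<zero>\<^bsub>N\<^esub>) \<in> K} = carrier M"
      using K(2) S(2)
      by (intro S(3) submodule_vimage[OF mods(1) MN.left_module_axioms mod_hom_inl[OF mods] K(1)]) auto
    moreover have "{y \<in> carrier N. (\<zero>\<^bsub>M\<^esub>, y) \<in> K} = carrier N"
      using K(2) T(2)
      by (intro T(3) submodule_vimage[OF mods(2) MN.left_module_axioms mod_hom_inr[OF mods] K(1)]) auto
    ultimately have "(x, \<zero>\<^bsub>N\<^esub>) \<in> K" "(\<zero>\<^bsub>M\<^esub>, y) \<in> K" if "x \<in> carrier M" "y \<in> carrier N" for x y
      using that by blast+
    then have "(x, y) \<in> K" if "x \<in> carrier M" "y \<in> carrier N" for x y
      using MN.submodule_add[OF K(1), of "(x, \<zero>\<^bsub>N\<^esub>)" "(\<zero>\<^bsub>M\<^esub>, y)"] that by simp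
    then show ?thesis using MN.submodule_subset[OF K(1)] by auto
  qed
  moreover have "finite ?U" "?U \<subseteq> carrier (prod_module M N)" using S T by auto
  ultimately show ?thesis
    using MN.left_module_axioms unfolding fg_module_def fin_gen_def by blast
qed

section \<open>Lifting along epimorphisms of arbitrary element types\<close>

text \<open>Bounds the size of \<open>M\<close>: its elements can be coded by sets of coefficient
  sequences. Only the image of \<open>c\<close> matters, so linearity is not asked for; infinite
  sequences avoid fixing the number of generators in the type.\<close>

lemma fg_module_coordinates:
  fixes L :: "('l, 'm) ring_scheme" and M :: "('l, 'a) module"
  assumes "fg_module L M"
  obtains c :: "(nat \<Rightarrow> 'l) \<Rightarrow> 'a" where "carrier M = c ` (UNIV \<rightarrow> carrier L)"
proof -
  interpret left_module L M using assms by (simp add: fg_module_def)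
  have "\<exists>c::(nat \<Rightarrow> 'l) \<Rightarrow> 'a. submodule (c ` (UNIV \<rightarrow> carrier L)) L M \<and> S \<subseteq> c ` (UNIV \<rightarrow> carrier L)"
    if "finite S" "S \<subseteq> carrier M" for S
    using that
  proof (induction S rule: finite_induct)
    case empty
    \<comment> \<open>The zero sequence shows that the set of sequences is nonempty, so the constant
      map has image exactly the zero submodule.\<close>
    have "(\<lambda>_ :: nat \<Rightarrow> 'l. \<zero>\<^bsub>M\<^esub>) ` (UNIV \<rightarrow> carrier L) = {\<zero>\<^bsub>M\<^esub>}" by (force intro!: image_eqI[of _ _ "\<lambda>_. \<zero>\<^bsub>L\<^esub>"])
    then show ?case
      using submodule_zero_set by (intro exI[of _ "\<lambda>_. \<zero>\<^bsub>M\<^esub>"]) auto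
  next
    case (insert s F)
    then obtain c :: "(nat \<Rightarrow> 'l) \<Rightarrow> 'a" where c: "submodule (c ` (UNIV \<rightarrow> carrier L)) L M" "F \<subseteq> c ` (UNIV \<rightarrow> carrier L)"
      by auto
    define K where "K = c ` (UNIV \<rightarrow> carrier L)"
    \<comment> \<open>The coefficient of the new generator takes index 0 and the old sequence is
      shifted by one; \<open>case_nat\<close> below undoes the shift.\<close>
    define d where "d v = c (\<lambda>i. v (Suc i)) \<oplus>\<^bsub>M\<^esub> v 0 \<odot>\<^bsub>M\<^esub> s" for v
    have s: "s \<in> carrier M" using insert.prems by simp
    have "submodule K L M" using c(1) by (simp add: K_def)
    note K = submodule_facts[OF this]
    have Kc: "x \<in> carrier M" if "x \<in> K" for x using that K(1) by auto
    have d: "d ` (UNIV \<rightarrow> carrier L) = {k \<oplus>\<^bsub>M\<^esub> a \<odot>\<^bsub>M\<^esub> s | k a. k \<in> K \<and> a \<in> carrier L}"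
    proof (intro equalityI subsetI)
      fix x assume "x \<in> {k \<oplus>\<^bsub>M\<^esub> a \<odot>\<^bsub>M\<^esub> s | k a. k \<in> K \<and> a \<in> carrier L}"
      then obtain v a where "v \<in> UNIV \<rightarrow> carrier L" "a \<in> carrier L" "x = c v \<oplus>\<^bsub>M\<^esub> a \<odot>\<^bsub>M\<^esub> s"
        unfolding K_def by blast
      then show "x \<in> d ` (UNIV \<rightarrow> carrier L)"
        by (intro image_eqI[of _ _ "case_nat a v"]) (auto simp: d_def Pi_iff split: nat.split)
    next
      fix x assume "x \<in> d ` (UNIV \<rightarrow> carrier L)"
      then show "x \<in> {k \<oplus>\<^bsub>M\<^esub> a \<odot>\<^bsub>M\<^esub> s | k a. k \<in> K \<and> a \<in> carrier L}"
        unfolding K_def d_def by blast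
    qed
    have "submodule (d ` (UNIV \<rightarrow> carrier L)) L M"
      unfolding d
    proof (rule submoduleI, goal_cases)
      case 1 then show ?case using s Kc by auto
    next
      case 2 then show ?case
        using s K(2) smult_l_null by (force intro: exI[of _ "\<zero>\<^bsub>M\<^esub>"] exI[of _ "\<zero>\<^bsub>L\<^esub>"])
    next
      case (3 a b)
      then obtain k r k' r' where "k \<in> K" "r \<in> carrier L" "a = k \<oplus>\<^bsub>M\<^esub> r \<odot>\<^bsub>M\<^esub> s"
          "k' \<in> K" "r' \<in> carrier L" "b = k' \<oplus>\<^bsub>M\<^esub> r' \<odot>\<^bsub>M\<^esub> s" by blast
      moreover from this have "a \<oplus>\<^bsub>M\<^esub> b = (k \<oplus>\<^bsub>M\<^esub> k') \<oplus>\<^bsub>M\<^esub> (r \<oplus>\<^bsub>L\<^esub> r') \<odot>\<^bsub>M\<^esub> s"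
        using s Kc by (simp add: smult_l_distr M.a_ac)
      ultimately show ?case using K(3) by blast
    next
      case (4 l x)
      then obtain k r where "k \<in> K" "r \<in> carrier L" "x = k \<oplus>\<^bsub>M\<^esub> r \<odot>\<^bsub>M\<^esub> s" by blast
      moreover from this 4 have "l \<odot>\<^bsub>M\<^esub> x = l \<odot>\<^bsub>M\<^esub> k \<oplus>\<^bsub>M\<^esub> (l \<otimes>\<^bsub>L\<^esub> r) \<odot>\<^bsub>M\<^esub> s"
        using s Kc by (simp add: smult_r_distr smult_assoc1)
      ultimately show ?case using K(5) 4(1) by blast
    qed
    moreover have "s \<in> d ` (UNIV \<rightarrow> carrier L)"
      unfolding d using s K(2) by (force intro: exI[of _ "\<zero>\<^bsub>M\<^esub>"] exI[of _ "\<one>\<^bsub>L\<^esub>"])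
    moreover have "F \<subseteq> d ` (UNIV \<rightarrow> carrier L)"
    proof
      fix x assume "x \<in> F"
      then have "x \<in> K" using c(2) K_def by auto
      then show "x \<in> d ` (UNIV \<rightarrow> carrier L)"
        unfolding d using s Kc smult_l_null by (force intro: exI[of _ x] exI[of _ "\<zero>\<^bsub>L\<^esub>"])
    qed
    ultimately show ?case by blast
  qed
  then show ?thesis
    using assms that unfolding fg_module_def fin_gen_def by metis
qed

text \<open>The structure that turns an injection \<open>e\<close> into an isomorphism onto its
  image, so that the element type changes and the module does not.\<close>

definition transport_module :: "('a \<Rightarrow> 'b) \<Rightarrow> ('l, 'a) module \<Rightarrow> ('l, 'b) module" where
  "transport_module e M =
     (let d = inv_into (carrier M) e in
      \<lparr>carrier = e ` carrier M, mult = (\<lambda>_ _. e \<zero>\<^bsub>M\<^esub>), one = e \<zero>\<^bsub>M\<^esub>, zero = e \<zero>\<^bsub>M\<^esub>,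
       add = (\<lambda>x y. e (d x \<oplus>\<^bsub>M\<^esub> d y)), smult = (\<lambda>l x. e (l \<odot>\<^bsub>M\<^esub> d x))\<rparr>)"

lemma transport_module:
  assumes "left_module L M" "inj_on e (carrier M)"
  shows left_module_transport: "left_module L (transport_module e M)"
    and mod_hom_transport: "e \<in> mod_hom L M (transport_module e M)"
    and bij_betw_transport: "bij_betw e (carrier M) (carrier (transport_module e M))"
proof -
  interpret left_module L M by fact
  have [simp]: "inv_into (carrier M) e (e x) = x" if "x \<in> carrier M" for x
    using assms(2) that by simp
  note t = transport_module_def Let_def
  have ag: "abelian_group (transport_module e M)"
  proof (rule abelian_groupI)
    fix x assume "x \<in> carrier (transport_module e M)"
    then obtain a where "a \<in> carrier M" "x = e a" by (auto simp: t)
    then show "\<exists>y\<in>carrier (transport_module e M).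
        y \<oplus>\<^bsub>transport_module e M\<^esub> x = \<zero>\<^bsub>transport_module e M\<^esub>"
      by (intro bexI[of _ "e (\<ominus>\<^bsub>M\<^esub> a)"]) (auto simp: t M.l_neg)
  qed (auto simp: t M.a_ac)
  show "left_module L (transport_module e M)"
    apply (intro left_module.intro L.ring_axioms ag left_module_axioms.intro)
    by (auto simp: t smult_l_distr smult_r_distr smult_assoc1)
  show "e \<in> mod_hom L M (transport_module e M)" by (auto simp: t mod_hom_def)
  show "bij_betw e (carrier M) (carrier (transport_module e M))"
    using assms(2) by (auto simp: t bij_betw_def)
qed

text \<open>Transfers the lifting properties, which only quantify over modules of this element type.\<close>

lemma fg_module_copy:
  fixes L :: "('l, 'm) ring_scheme" and M :: "('l, 'a) module"
  assumes "fg_module L M"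
  obtains M' :: "('l, (nat \<Rightarrow> 'l) set) module" and e d
  where "fg_module L M'" "e \<in> mod_hom L M M'" "d \<in> mod_hom L M' M"
    "\<And>x. x \<in> carrier M \<Longrightarrow> d (e x) = x" "\<And>y. y \<in> carrier M' \<Longrightarrow> e (d y) = y"
proof -
  have M: "left_module L M" using assms by (simp add: fg_module_def)
  obtain c :: "(nat \<Rightarrow> 'l) \<Rightarrow> 'a" where c: "carrier M = c ` (UNIV \<rightarrow> carrier L)"
    using fg_module_coordinates[OF assms] by blast
  \<comment> \<open>An element is coded by its fibre under \<open>c\<close>. The fibres over the
    carrier are nonempty, so equal fibres belong to equal elements.\<close>
  define e where "e x = {v \<in> UNIV \<rightarrow> carrier L. c v = x}" for x
  define M' where "M' = transport_module e M"
  have "inj_on e (carrier M)"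
  proof (rule inj_onI)
    fix x y assume x: "x \<in> carrier M" and eq: "e x = e y"
    obtain v where v: "v \<in> UNIV \<rightarrow> carrier L" "x = c v" by (rule imageE[OF x[unfolded c]])
    then have "v \<in> e x" by (simp add: e_def)
    then have "v \<in> e y" unfolding eq .
    then show "x = y" using v(2) by (simp add: e_def)
  qed
  note t = transport_module[OF M this, folded M'_def]
  have "fg_module L M'"
    using fg_module_surj[OF assms t(1,2)] t(3) by (simp add: bij_betw_def)
  moreover have "inv_into (carrier M) e \<in> mod_hom L M' M" by (rule mod_hom_inv_into) (fact M t)+
  ultimately show ?thesis
    using that[of M' e "inv_into (carrier M) e"] t
    by (auto simp: bij_betw_def inv_into_f_f f_inv_into_f)
qed

text \<open>The definition of projectivity applies to copies of \<open>M\<close> and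
  \<open>N\<close> on the tested element type; the lift found there is carried back by
  \<open>d\<close>.\<close>

lemma projective_module_lift:
  assumes P: "projective_module L P" and M: "fg_module L M" and N: "left_module L N"
    and p: "p \<in> mod_hom L M N" "p ` carrier M = carrier N" and f: "f \<in> mod_hom L P N"
  obtains h where "h \<in> mod_hom L P M" "\<And>x. x \<in> carrier P \<Longrightarrow> p (h x) = f x"
proof -
  obtain M' :: "('a, (nat \<Rightarrow> 'a) set) module" and e d where
    M': "fg_module L M'" "e \<in> mod_hom L M M'" "d \<in> mod_hom L M' M"
      "\<And>x. x \<in> carrier M \<Longrightarrow> d (e x) = x" "\<And>y. y \<in> carrier M' \<Longrightarrow> e (d y) = y"
    using fg_module_copy[OF M] by metis
  \<comment> \<open>\<open>N\<close> is finitely generated as the image of \<open>M\<close>, so it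
    has a copy too.\<close>
  obtain N' :: "('a, (nat \<Rightarrow> 'a) set) module" and e' d' where
    N': "fg_module L N'" "e' \<in> mod_hom L N N'" "d' \<in> mod_hom L N' N"
      "\<And>x. x \<in> carrier N \<Longrightarrow> d' (e' x) = x" "\<And>y. y \<in> carrier N' \<Longrightarrow> e' (d' y) = y"
    using fg_module_copy[OF fg_module_surj[OF M N p]] by metis
  let ?p = "\<lambda>x. e' (p (d x))" and ?f = "\<lambda>x. e' (f x)"
  have "?p \<in> mod_hom L M' N'" "?f \<in> mod_hom L P N'"
    by (rule mod_hom_comp[OF mod_hom_comp[OF M'(3) p(1)] N'(2)], rule mod_hom_comp[OF f N'(2)])
  moreover have "?p ` carrier M' = carrier N'"
  proof (intro equalityI subsetI)
    fix y assume y: "y \<in> carrier N'"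
    then obtain x where x: "x \<in> carrier M" "p x = d' y"
      using p(2) mod_hom_closed[OF N'(3)] by (metis imageE)
    then have "?p (e x) = y" using M'(4) N'(5) y by simp
    then show "y \<in> ?p ` carrier M'" using mod_hom_closed[OF M'(2) x(1)] by blast
  qed (use \<open>?p \<in> mod_hom L M' N'\<close> in \<open>auto intro: mod_hom_closed\<close>)
  ultimately obtain h where h: "h \<in> mod_hom L P M'" "\<And>x. x \<in> carrier P \<Longrightarrow> ?p (h x) = ?f x"
    using P M'(1) N'(1) unfolding projective_module_def by metis
  show ?thesis
  proof
    show "(\<lambda>x. d (h x)) \<in> mod_hom L P M" by (rule mod_hom_comp[OF h(1) M'(3)])
    fix x assume x: "x \<in> carrier P"
    then have "d' (e' (p (d (h x)))) = d' (e' (f x))" using h(2) by simp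
    then show "p (d (h x)) = f x"
      using N'(4) x mod_hom_closed[OF f] mod_hom_closed[OF p(1)] mod_hom_closed[OF M'(3)]
        mod_hom_closed[OF h(1)] by simp
  qed
qed

text \<open>The argument of \<open>projective_module_lift\<close>, with a copy for the source and
  the target of each of the two objects.\<close>

lemma H_projective_lift:
  assumes P: "H_projective L P" and M: "H_obj L M" and N: "H_obj L N"
    and p: "H_epi L M p N" and f: "f \<in> H_hom L P N"
  obtains h where "h \<in> H_hom L P M"
    "\<And>x. x \<in> carrier (src P) \<Longrightarrow> fst p (fst h x) = fst f x"
    "\<And>y. y \<in> carrier (tgt P) \<Longrightarrow> snd p (snd h y) = snd f y"
proof -
  have fg: "fg_module L (src M)" "fg_module L (tgt M)" "fg_module L (src N)" "fg_module L (tgt N)"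
    and am: "arr M \<in> mod_hom L (src M) (tgt M)" and an: "arr N \<in> mod_hom L (src N) (tgt N)"
    using M N by (auto simp: H_obj_def)
  obtain p1 p2 f1 f2 where pf: "p = (p1, p2)" "f = (f1, f2)" by (metis surj_pair)
  have p1: "p1 \<in> mod_hom L (src M) (src N)" "p1 ` carrier (src M) = carrier (src N)"
    and p2: "p2 \<in> mod_hom L (tgt M) (tgt N)" "p2 ` carrier (tgt M) = carrier (tgt N)"
    and pc: "\<And>x. x \<in> carrier (src M) \<Longrightarrow> arr N (p1 x) = p2 (arr M x)"
    using p by (auto simp: H_epi_def H_hom_def pf)
  have f1: "f1 \<in> mod_hom L (src P) (src N)" and f2: "f2 \<in> mod_hom L (tgt P) (tgt N)"
    and fc: "\<And>x. x \<in> carrier (src P) \<Longrightarrow> arr N (f1 x) = f2 (arr P x)"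
    using f by (auto simp: H_hom_def pf)
  obtain M1 :: "('a, (nat \<Rightarrow> 'a) set) module" and e1 d1 where
    M1: "fg_module L M1" "e1 \<in> mod_hom L (src M) M1" "d1 \<in> mod_hom L M1 (src M)"
      "\<And>x. x \<in> carrier (src M) \<Longrightarrow> d1 (e1 x) = x" "\<And>y. y \<in> carrier M1 \<Longrightarrow> e1 (d1 y) = y"
    using fg_module_copy[OF fg(1)] by metis
  obtain M2 :: "('a, (nat \<Rightarrow> 'a) set) module" and e2 d2 where
    M2: "fg_module L M2" "e2 \<in> mod_hom L (tgt M) M2" "d2 \<in> mod_hom L M2 (tgt M)"
      "\<And>x. x \<in> carrier (tgt M) \<Longrightarrow> d2 (e2 x) = x" "\<And>y. y \<in> carrier M2 \<Longrightarrow> e2 (d2 y) = y"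
    using fg_module_copy[OF fg(2)] by metis
  obtain N1 :: "('a, (nat \<Rightarrow> 'a) set) module" and c1 b1 where
    N1: "fg_module L N1" "c1 \<in> mod_hom L (src N) N1" "b1 \<in> mod_hom L N1 (src N)"
      "\<And>x. x \<in> carrier (src N) \<Longrightarrow> b1 (c1 x) = x" "\<And>y. y \<in> carrier N1 \<Longrightarrow> c1 (b1 y) = y"
    using fg_module_copy[OF fg(3)] by metis
  obtain N2 :: "('a, (nat \<Rightarrow> 'a) set) module" and c2 b2 where
    N2: "fg_module L N2" "c2 \<in> mod_hom L (tgt N) N2" "b2 \<in> mod_hom L N2 (tgt N)"
      "\<And>x. x \<in> carrier (tgt N) \<Longrightarrow> b2 (c2 x) = x" "\<And>y. y \<in> carrier N2 \<Longrightarrow> c2 (b2 y) = y"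
    using fg_module_copy[OF fg(4)] by metis
  note cl = M1(2,3) M2(2,3) N1(2,3) N2(2,3) am an p1(1) p2(1) f1 f2
  note cl' = cl[THEN mod_hom_closed]
  \<comment> \<open>Conjugating the arrows by the copying isomorphisms makes these isomorphisms
    morphisms of \<open>\<H>\<close>, so commuting squares stay commuting.\<close>
  define M' where "M' = \<lparr>src = M1, tgt = M2, arr = (\<lambda>x. e2 (arr M (d1 x)))\<rparr>"
  define N' where "N' = \<lparr>src = N1, tgt = N2, arr = (\<lambda>x. c2 (arr N (b1 x)))\<rparr>"
  have "H_obj L M'" "H_obj L N'"
    unfolding H_obj_def M'_def N'_def
    using M1(1) M2(1) N1(1) N2(1) mod_hom_comp[OF mod_hom_comp[OF M1(3) am] M2(2)]
      mod_hom_comp[OF mod_hom_comp[OF N1(3) an] N2(2)] by auto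
  moreover have "H_epi L M' (\<lambda>x. c1 (p1 (d1 x)), \<lambda>x. c2 (p2 (d2 x))) N'"
  proof -
    have "y \<in> (\<lambda>x. c1 (p1 (d1 x))) ` carrier M1" if y: "y \<in> carrier N1" for y
    proof -
      obtain x where "x \<in> carrier (src M)" "p1 x = b1 y" using p1(2) cl'(6)[OF y] by (metis imageE)
      then show ?thesis
        using M1(4) N1(5) y cl'(1) by (intro image_eqI[of _ _ "e1 x"]) auto
    qed
    moreover have "y \<in> (\<lambda>x. c2 (p2 (d2 x))) ` carrier M2" if y: "y \<in> carrier N2" for y
    proof -
      obtain x where "x \<in> carrier (tgt M)" "p2 x = b2 y" using p2(2) cl'(8)[OF y] by (metis imageE)
      then show ?thesis
        using M2(4) N2(5) y cl'(3) by (intro image_eqI[of _ _ "e2 x"]) auto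
    qed
    ultimately show ?thesis
      using mod_hom_comp[OF mod_hom_comp[OF M1(3) p1(1)] N1(2)]
        mod_hom_comp[OF mod_hom_comp[OF M2(3) p2(1)] N2(2)]
      by (auto simp: H_epi_def H_hom_def M'_def N'_def N1(4) M2(4) pc cl')
  qed
  moreover have "(\<lambda>x. c1 (f1 x), \<lambda>x. c2 (f2 x)) \<in> H_hom L P N'"
    using mod_hom_comp[OF f1 N1(2)] mod_hom_comp[OF f2 N2(2)]
    by (auto simp: H_hom_def N'_def N1(4) fc cl')
  ultimately have "\<exists>h\<in>H_hom L P M'.
      (\<forall>x\<in>carrier (src P). c1 (p1 (d1 (fst h x))) = c1 (f1 x)) \<and>
      (\<forall>x\<in>carrier (tgt P). c2 (p2 (d2 (snd h x))) = c2 (f2 x))"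
    using P unfolding H_projective_def by fastforce
  then obtain h1 h2 where h: "(h1, h2) \<in> H_hom L P M'"
    "\<And>x. x \<in> carrier (src P) \<Longrightarrow> c1 (p1 (d1 (h1 x))) = c1 (f1 x)"
    "\<And>x. x \<in> carrier (tgt P) \<Longrightarrow> c2 (p2 (d2 (h2 x))) = c2 (f2 x)"
    by auto
  have h1: "h1 \<in> mod_hom L (src P) M1" and h2: "h2 \<in> mod_hom L (tgt P) M2"
    and hc: "\<And>x. x \<in> carrier (src P) \<Longrightarrow> e2 (arr M (d1 (h1 x))) = h2 (arr P x)"
    using h(1) by (auto simp: H_hom_def M'_def)
  note hcl = h1[THEN mod_hom_closed] h2[THEN mod_hom_closed]
  have aP: "arr P x \<in> carrier (tgt P)" if "x \<in> carrier (src P)" for x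
    using P that by (auto simp: H_projective_def H_obj_def intro: mod_hom_closed)
  show ?thesis
  proof
    show "(\<lambda>x. d1 (h1 x), \<lambda>x. d2 (h2 x)) \<in> H_hom L P M"
      using mod_hom_comp[OF h1 M1(3)] mod_hom_comp[OF h2 M2(3)]
      by (auto simp: H_hom_def hc[symmetric] M2(4) cl' hcl)
  next
    fix x assume x: "x \<in> carrier (src P)"
    then have "b1 (c1 (p1 (d1 (h1 x)))) = b1 (c1 (f1 x))" using h(2) by simp
    then show "fst p (fst (\<lambda>x. d1 (h1 x), \<lambda>x. d2 (h2 x)) x) = fst f x"
      using x N1(4) by (simp add: pf cl' hcl)
  next
    fix x assume x: "x \<in> carrier (tgt P)"
    then have "b2 (c2 (p2 (d2 (h2 x)))) = b2 (c2 (f2 x))" using h(3) by simp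
    then show "snd p (snd (\<lambda>x. d1 (h1 x), \<lambda>x. d2 (h2 x)) x) = snd f x"
      using x N2(4) by (simp add: pf cl' hcl)
  qed
qed

section \<open>Quotients and duals\<close>

lemma left_module_regular: "ring L \<Longrightarrow> left_module L (regular_module L)"
proof -
  assume "ring L" then interpret ring L .
  have "abelian_group (regular_module L)"
    by (rule abelian_groupI)
      (auto simp: regular_module_def a_ac intro: bexI[of _ "\<ominus>\<^bsub>L\<^esub> x" for x] l_neg)
  then show ?thesis
    by (intro left_module.intro left_module_axioms.intro ring_axioms)
      (auto simp: regular_module_def l_distr r_distr m_assoc)
qed

lemma quotient_module_coset_eq_iff:
  assumes "left_module L M" "submodule N L M" "x \<in> carrier M" "y \<in> carrier M"
  shows "N +>\<^bsub>M\<^esub> x = N +>\<^bsub>M\<^esub> y \<longleftrightarrow> (\<exists>n\<in>N. x = n \<oplus>\<^bsub>M\<^esub> y)"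
proof -
  interpret left_module L M by fact
  interpret N: submodule N L M by fact
  interpret ad: abelian_subgroup N M
    by (rule abelian_subgroupI3)
      (auto simp: additive_subgroup_def N.subgroup_axioms M.abelian_group_axioms)
  have "x \<in> N +>\<^bsub>M\<^esub> x" by (rule ad.a_rcos_self) fact
  moreover have "N +>\<^bsub>M\<^esub> x = N +>\<^bsub>M\<^esub> y" if "x \<in> N +>\<^bsub>M\<^esub> y"
    by (rule ad.a_repr_independence'[symmetric]) (fact that assms)+
  ultimately have "N +>\<^bsub>M\<^esub> x = N +>\<^bsub>M\<^esub> y \<longleftrightarrow> x \<in> N +>\<^bsub>M\<^esub> y" by blast
  then show ?thesis by (auto simp: a_r_coset_def')
qed

lemma quotient_module_proj:
  assumes "left_module L M" "submodule N L M"
  shows "(\<lambda>x. N +>\<^bsub>M\<^esub> x) \<in> mod_hom L M (quotient_module M N)"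
    and "carrier (quotient_module M N) = (\<lambda>x. N +>\<^bsub>M\<^esub> x) ` carrier M"
proof -
  interpret left_module L M by fact
  interpret N: submodule N L M by fact
  interpret ad: abelian_subgroup N M
    by (rule abelian_subgroupI3)
      (auto simp: additive_subgroup_def N.subgroup_axioms M.abelian_group_axioms)
  show c: "carrier (quotient_module M N) = (\<lambda>x. N +>\<^bsub>M\<^esub> x) ` carrier M"
    by (auto simp: quotient_module_def A_RCOSETS_def')
  show "(\<lambda>x. N +>\<^bsub>M\<^esub> x) \<in> mod_hom L M (quotient_module M N)"
  proof (rule mod_homI)
    fix x y assume "x \<in> carrier M" "y \<in> carrier M"
    then show "N +>\<^bsub>M\<^esub> (x \<oplus>\<^bsub>M\<^esub> y) = (N +>\<^bsub>M\<^esub> x) \<oplus>\<^bsub>quotient_module M N\<^esub> (N +>\<^bsub>M\<^esub> y)"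
      by (simp add: quotient_module_def ad.a_rcos_sum)
  qed (simp_all add: c quotient_module_smult[OF assms])
qed

section \<open>Homomorphisms into the ring, and functoriality of both dualities\<close>

lemma star_obj_simps [simp]:
  "b \<in> carrier M \<Longrightarrow> (u \<oplus>\<^bsub>star_obj L M\<^esub> w) b = u b \<oplus>\<^bsub>L\<^esub> w b"
  "b \<in> carrier M \<Longrightarrow> \<zero>\<^bsub>star_obj L M\<^esub> b = \<zero>\<^bsub>L\<^esub>"
  by (simp_all add: star_obj_def)

lemma precomp_apply [simp]: "x \<in> carrier M \<Longrightarrow> precomp M f g x = g (f x)"
  by (simp add: precomp_def compose_def)

lemma star_obj_carrierD:
  assumes "u \<in> carrier (star_obj L M)"
  shows star_obj_mod_hom: "u \<in> mod_hom L M (regular_module L)"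
    and star_obj_closed: "x \<in> carrier M \<Longrightarrow> u x \<in> carrier L"
    and star_obj_add: "\<lbrakk>x \<in> carrier M; y \<in> carrier M\<rbrakk> \<Longrightarrow> u (x \<oplus>\<^bsub>M\<^esub> y) = u x \<oplus>\<^bsub>L\<^esub> u y"
  using assms by (auto simp: star_obj_def mod_hom_def regular_module_def)

lemma star_obj_zero:
  assumes "left_module L M" "u \<in> carrier (star_obj L M)"
  shows "u \<zero>\<^bsub>M\<^esub> = \<zero>\<^bsub>L\<^esub>"
  using mod_hom_zero[OF assms(1) left_module_regular star_obj_mod_hom[OF assms(2)]] assms(1)
  by (simp add: left_module_def regular_module_def)

lemma star_obj_ext:
  assumes "u \<in> carrier (star_obj L M)" "w \<in> carrier (star_obj L M)"
    and "\<And>x. x \<in> carrier M \<Longrightarrow> u x = w x"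
  shows "u = w"
  using assms by (auto simp: star_obj_def intro: extensionalityI)

text \<open>Negation is not a field of the record \<open>star_obj\<close>; its values come from
  uniqueness of additive inverses in \<open>L\<close>.\<close>

lemma star_obj_minus:
  assumes "left_module L M" "u \<in> carrier (star_obj L M)" "x \<in> carrier M"
  shows "(\<ominus>\<^bsub>star_obj L M\<^esub> u) x = \<ominus>\<^bsub>L\<^esub> (u x)"
proof -
  interpret M: left_module L M by fact
  interpret S: left_module "opposite L" "star_obj L M" by (rule star_obj_module) fact
  have "(\<ominus>\<^bsub>star_obj L M\<^esub> u) x \<oplus>\<^bsub>L\<^esub> u x = (\<ominus>\<^bsub>star_obj L M\<^esub> u \<oplus>\<^bsub>star_obj L M\<^esub> u) x"
    using assms(3) by simp
  also have "\<dots> = \<zero>\<^bsub>L\<^esub>" using assms(2,3) by (simp add: S.M.l_neg)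
  finally show ?thesis
    using assms(2,3) by (metis M.L.minus_equality S.M.a_inv_closed star_obj_closed)
qed

lemma precomp_star:
  assumes "left_module L M" "f \<in> mod_hom L M N"
  shows "precomp M f \<in> mod_hom (opposite L) (star_obj L N) (star_obj L M)"
proof -
  interpret left_module L M by fact
  show ?thesis
    by (rule mod_homI)
      (auto simp: precomp_def compose_def star_obj_def opposite_def regular_module_def
        mod_homD[OF assms(2)] mod_hom_def[where L = L] Pi_iff)
qed

text \<open>Closure is assumed in place of the module axioms because
  \<open>bij_betw_precomp_D\<close> applies this to a target whose closure is known only through a
  bijection with a module.\<close>

lemma precomp_D_closed:
  assumes "\<And>x y. \<lbrakk>x \<in> carrier M; y \<in> carrier M\<rbrakk> \<Longrightarrow> x \<oplus>\<^bsub>M\<^esub> y \<in> carrier M"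
    and "\<And>l x. \<lbrakk>l \<in> carrier L; x \<in> carrier M\<rbrakk> \<Longrightarrow> l \<odot>\<^bsub>M\<^esub> x \<in> carrier M"
    and "f \<in> mod_hom L M N" "\<phi> \<in> carrier R \<rightarrow> carrier L" "u \<in> carrier (D_obj R \<phi> J N)"
  shows "precomp M f u \<in> carrier (D_obj R \<phi> J M)"
  using assms(5) funcset_mem[OF assms(4)] assms(1,2)
  by (auto simp: D_obj_def precomp_def compose_def mod_homD[OF assms(3)]
      restrict_scalars_def mod_hom_def[of R] Pi_iff)

text \<open>The duals are modules over the opposite ring, yet linearity can be stated over
  \<open>L\<close>: \<open>mod_hom\<close> refers to the ring only through its carrier, which
  \<open>opposite\<close> keeps.\<close>

lemma precomp_D:
  assumes "left_module L M" "f \<in> mod_hom L M N" "\<phi> \<in> carrier R \<rightarrow> carrier L"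
  shows "precomp M f \<in> mod_hom L (D_obj R \<phi> J N) (D_obj R \<phi> J M)"
proof -
  interpret left_module L M by fact
  show ?thesis
  proof (rule mod_homI)
    fix u assume "u \<in> carrier (D_obj R \<phi> J N)"
    then show "precomp M f u \<in> carrier (D_obj R \<phi> J M)"
      by (intro precomp_D_closed[OF _ _ assms(2,3)]) auto
  qed (auto simp: precomp_def compose_def D_obj_def mod_homD[OF assms(2)])
qed

text \<open>The inverse is precomposition with the inverse of \<open>f\<close>. Dual elements are
  extensional, so the two composites are identities as soon as they are so pointwise on the
  carriers.\<close>

lemma bij_betw_precomp_D:
  assumes M: "left_module L M" and f: "f \<in> mod_hom L M N" "bij_betw f (carrier M) (carrier N)"
    and \<phi>: "\<phi> \<in> carrier R \<rightarrow> carrier L"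
  shows "bij_betw (precomp M f) (carrier (D_obj R \<phi> J N)) (carrier (D_obj R \<phi> J M))"
proof -
  interpret left_module L M by fact
  let ?g = "inv_into (carrier M) f"
  have g: "?g \<in> mod_hom L N M" by (rule mod_hom_inv_into) fact+
  have N: "x \<in> f ` carrier M" if "x \<in> carrier N" for x using f(2) that by (simp add: bij_betw_def)
  have ext: "u \<in> extensional (carrier X)" if "u \<in> carrier (D_obj R \<phi> J X)" for u and X :: "('a, 'z) module"
    using that by (simp add: D_obj_def)
  have fg: "f (?g y) = y" if "y \<in> carrier N" for y using N[OF that] by (rule f_inv_into_f)
  have gf: "?g (f x) = x" if "x \<in> carrier M" for x using f(2) that by (simp add: bij_betw_def)
  show ?thesis
  proof (rule bij_betwI[where g = "precomp N ?g"])
    show "precomp M f \<in> carrier (D_obj R \<phi> J N) \<rightarrow> carrier (D_obj R \<phi> J M)"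
      using mod_hom_closed[OF precomp_D[OF M f(1) \<phi>]] by blast
    \<comment> \<open>\<open>N\<close> inherits closure from \<open>M\<close>: a sum in
      \<open>N\<close> is \<open>f\<close> of the sum of the preimages.\<close>
    have "x \<oplus>\<^bsub>N\<^esub> y \<in> carrier N" if "x \<in> carrier N" "y \<in> carrier N" for x y
    proof -
      have "f (?g x \<oplus>\<^bsub>M\<^esub> ?g y) \<in> carrier N" using that by (intro mod_hom_closed[OF f(1)] M.a_closed mod_hom_closed[OF g])
      then show ?thesis using that by (simp add: mod_hom_add[OF f(1)] mod_hom_closed[OF g] fg)
    qed
    moreover have "l \<odot>\<^bsub>N\<^esub> x \<in> carrier N" if "l \<in> carrier L" "x \<in> carrier N" for l x
    proof -
      have "f (l \<odot>\<^bsub>M\<^esub> ?g x) \<in> carrier N" using that by (intro mod_hom_closed[OF f(1)] smult_closed mod_hom_closed[OF g])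
      then show ?thesis using that by (simp add: mod_hom_smult[OF f(1)] mod_hom_closed[OF g] fg)
    qed
    ultimately show "precomp N ?g \<in> carrier (D_obj R \<phi> J M) \<rightarrow> carrier (D_obj R \<phi> J N)"
      using precomp_D_closed[OF _ _ g \<phi>] by blast
  next
    fix u assume u: "u \<in> carrier (D_obj R \<phi> J N)"
    show "precomp N ?g (precomp M f u) = u"
      by (rule extensionalityI[OF _ ext[OF u]])
        (auto simp: precomp_def compose_def fg mod_hom_closed[OF g])
  next
    fix u assume u: "u \<in> carrier (D_obj R \<phi> J M)"
    show "precomp M f (precomp N ?g u) = u"
      by (rule extensionalityI[OF _ ext[OF u]])
        (auto simp: precomp_def compose_def gf mod_hom_closed[OF f(1)])
  qed
qed

text \<open>Duality reverses the direction and exchanges source and target, so \<open>h2\<close>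
  induces the first component and \<open>h1\<close> the second.\<close>

lemma H_iso_H_D:
  assumes "left_module L (src X)" "left_module L (tgt X)"
    and h: "(h1, h2) \<in> H_hom L X Y" "bij_betw h1 (carrier (src X)) (carrier (src Y))"
      "bij_betw h2 (carrier (tgt X)) (carrier (tgt Y))"
    and a: "arr X \<in> carrier (src X) \<rightarrow> carrier (tgt X)"
    and \<phi>: "\<phi> \<in> carrier R \<rightarrow> carrier L"
  shows "H_iso L (H_D R \<phi> J Y) (H_D R \<phi> J X)"
proof -
  have h1: "h1 \<in> mod_hom L (src X) (src Y)" and h2: "h2 \<in> mod_hom L (tgt X) (tgt Y)"
    and c: "\<And>x. x \<in> carrier (src X) \<Longrightarrow> arr Y (h1 x) = h2 (arr X x)"
    using h(1) by (auto simp: H_hom_def)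
  have "(precomp (tgt X) h2, precomp (src X) h1) \<in> H_hom L (H_D R \<phi> J Y) (H_D R \<phi> J X)"
    using precomp_D[OF assms(2) h2 \<phi>] precomp_D[OF assms(1) h1 \<phi>] funcset_mem[OF a] mod_hom_closed[OF h1]
    by (auto simp: H_hom_def H_D_def precomp_def compose_def c intro!: restrict_ext)
  then show ?thesis
    unfolding H_iso_def
    using bij_betw_precomp_D[OF assms(2) h2 h(3) \<phi>] bij_betw_precomp_D[OF assms(1) h1 h(2) \<phi>]
    by (fastforce simp: H_D_def)
qed

section \<open>The cokernel of the dualized presentation\<close>

text \<open>
  The maps \<open>\<rho>\<close>, \<open>\<kappa>\<close>, \<open>\<sigma>\<close> exhibit the target of \<open>Q1\<close> as the biproduct of \<open>P1\<close> and \<open>P0\<close>, and \<open>\<theta>\<close>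
  identifies \<open>P0\<close> with the target of \<open>Q0\<close>. The isomorphisms are \<open>u \<mapsto> u \<rho>1\<close> and \<open>v \<mapsto> -v \<rho>0\<close>; the
  sign is forced since \<open>v \<theta>' g2 = v \<alpha> \<rho>1 + v \<rho>0\<close> vanishes in the cokernel.
\<close>

lemma coker_star_iso:
  fixes L :: "('l, 'n) ring_scheme"
  assumes mods: "left_module L P1" "left_module L P0" "left_module L (src Q1)" "left_module L (tgt Q1)"
      "left_module L (tgt Q0)"
    and homs: "\<alpha> \<in> mod_hom L P1 P0" "arr Q1 \<in> mod_hom L (src Q1) (tgt Q1)"
      "g2 \<in> mod_hom L (tgt Q1) (tgt Q0)"
      "\<rho>1 \<in> mod_hom L (tgt Q1) P1" "\<rho>0 \<in> mod_hom L (tgt Q1) P0"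
      "\<kappa> \<in> mod_hom L P1 (src Q1)" "\<sigma> \<in> mod_hom L P0 (tgt Q1)"
      "\<theta> \<in> mod_hom L P0 (tgt Q0)" "\<theta>' \<in> mod_hom L (tgt Q0) P0"
    and f0: "arr Q0 ` carrier (src Q0) = carrier (tgt Q0)"
    and \<rho>1: "\<And>x. x \<in> carrier P1 \<Longrightarrow> \<rho>1 (arr Q1 (\<kappa> x)) = x" "\<And>y. y \<in> carrier P0 \<Longrightarrow> \<rho>1 (\<sigma> y) = \<zero>\<^bsub>P1\<^esub>"
    and \<rho>0: "\<And>a. a \<in> carrier (src Q1) \<Longrightarrow> \<rho>0 (arr Q1 a) = \<zero>\<^bsub>P0\<^esub>" "\<And>y. y \<in> carrier P0 \<Longrightarrow> \<rho>0 (\<sigma> y) = y"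
    and dec: "\<And>b. b \<in> carrier (tgt Q1) \<Longrightarrow> b = arr Q1 (\<kappa> (\<rho>1 b)) \<oplus>\<^bsub>tgt Q1\<^esub> \<sigma> (\<rho>0 b)"
    and g2: "\<And>x. x \<in> carrier P1 \<Longrightarrow> g2 (arr Q1 (\<kappa> x)) = \<theta> (\<alpha> x)" "\<And>y. y \<in> carrier P0 \<Longrightarrow> g2 (\<sigma> y) = \<theta> y"
    and \<theta>: "\<And>y. y \<in> carrier P0 \<Longrightarrow> \<theta>' (\<theta> y) = y" "\<And>z. z \<in> carrier (tgt Q0) \<Longrightarrow> \<theta> (\<theta>' z) = z"
  obtains \<psi>0 \<psi>1 where
    "(\<psi>0, \<psi>1) \<in> H_hom (opposite L) \<lparr>src = star_obj L P0, tgt = star_obj L P1, arr = precomp P1 \<alpha>\<rparr>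
       (H_coker (H_star L Q0) (H_star_map Q1 (g1, g2)) (H_star L Q1))"
    "bij_betw \<psi>0 (carrier (star_obj L P0)) (carrier (src (H_coker (H_star L Q0) (H_star_map Q1 (g1, g2)) (H_star L Q1))))"
    "bij_betw \<psi>1 (carrier (star_obj L P1)) (carrier (tgt (H_coker (H_star L Q0) (H_star_map Q1 (g1, g2)) (H_star L Q1))))"
proof -
  define A1 B1 B0 f1 where defs: "A1 = src Q1" "B1 = tgt Q1" "B0 = tgt Q0" "f1 = arr Q1"
  let ?S = "star_obj L" and ?K = "opposite L"
  note mods = mods[folded defs] and homs = homs[folded defs] and \<rho>1 = \<rho>1[folded defs]
    and \<rho>0 = \<rho>0[folded defs] and dec = dec[folded defs] and g2 = g2[folded defs] and \<theta> = \<theta>[folded defs]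
  note cl = homs[THEN mod_hom_closed]
  interpret P1: left_module L P1 by (rule mods)
  interpret P0: left_module L P0 by (rule mods)
  interpret S1: left_module ?K "?S P1" by (rule star_obj_module, rule mods)
  interpret S0: left_module ?K "?S P0" by (rule star_obj_module, rule mods)
  interpret SB: left_module ?K "?S B1" by (rule star_obj_module, rule mods)
  interpret SB0: left_module ?K "?S B0" by (rule star_obj_module, rule mods)
  note star = mod_hom_closed[OF precomp_star]
  \<comment> \<open>After the identifications, \<open>g2\<close> is the map
    \<open>(\<alpha>, 1)\<close> from \<open>P1 \<oplus> P0\<close> to \<open>P0\<close>.\<close>
  have \<theta>'g2: "\<theta>' (g2 b) = \<alpha> (\<rho>1 b) \<oplus>\<^bsub>P0\<^esub> \<rho>0 b" if b: "b \<in> carrier B1" for b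
  proof -
    have "g2 b = g2 (f1 (\<kappa> (\<rho>1 b)) \<oplus>\<^bsub>B1\<^esub> \<sigma> (\<rho>0 b))" using dec[OF b] by simp
    also have "\<dots> = \<theta> (\<alpha> (\<rho>1 b)) \<oplus>\<^bsub>B0\<^esub> \<theta> (\<rho>0 b)"
      using b by (simp add: mod_hom_add[OF homs(3)] cl g2)
    finally show ?thesis using b by (simp add: mod_hom_add[OF homs(9)] cl \<theta>)
  qed
  \<comment> \<open>The functionals on \<open>B1\<close> that vanish on the image of
    \<open>f1\<close>, that is, on the summand \<open>P1\<close>; they will be matched with
    \<open>P0\<^sup>*\<close>.\<close>
  define N where "N = a_kernel (?S B1) (?S A1) (precomp A1 f1)"
  define X where "X = sub_module (?S B1) N"
  have Nsub: "submodule N ?K (?S B1)"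
    unfolding N_def by (rule submodule_kernel[OF _ _ precomp_star]) (intro star_obj_module mods homs)+
  have X: "left_module ?K X" unfolding X_def by (rule left_module_sub_module[OF SB.left_module_axioms Nsub])
  define I where "I = precomp B1 g2 ` carrier (?S B0)"
  have I: "submodule I ?K (?S B1)"
    unfolding I_def
    by (rule submodule_image[OF SB0.left_module_axioms SB.left_module_axioms
          precomp_star[OF mods(4) homs(3)] SB0.submodule_carrier])
  note q = quotient_module_proj[OF SB.left_module_axioms I]
  have dom0: "a_kernel (?S B0) (?S (src Q0)) (precomp (src Q0) (arr Q0)) = {\<zero>\<^bsub>?S B0\<^esub>}"
  proof (intro equalityI subsetI)
    fix u assume "u \<in> a_kernel (?S B0) (?S (src Q0)) (precomp (src Q0) (arr Q0))"
    then have u: "u \<in> carrier (?S B0)" and *: "precomp (src Q0) (arr Q0) u = \<zero>\<^bsub>?S (src Q0)\<^esub>"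
      by (auto simp: a_kernel_def')
    have "u (arr Q0 a) = \<zero>\<^bsub>L\<^esub>" if "a \<in> carrier (src Q0)" for a
      using fun_cong[OF *, of a] that by simp
    then have "u z = \<zero>\<^bsub>L\<^esub>" if "z \<in> carrier B0" for z using that f0 unfolding defs by (metis imageE)
    then have "u = \<zero>\<^bsub>?S B0\<^esub>" by (intro star_obj_ext[OF u]) auto
    then show "u \<in> {\<zero>\<^bsub>?S B0\<^esub>}" by simp
  next
    have "arr Q0 a \<in> carrier B0" if "a \<in> carrier (src Q0)" for a using that f0 by (auto simp: defs)
    then have "precomp (src Q0) (arr Q0) \<zero>\<^bsub>?S B0\<^esub> = \<zero>\<^bsub>?S (src Q0)\<^esub>"
      by (auto simp: precomp_def compose_def star_obj_def intro!: restrict_ext)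
    then show "u \<in> a_kernel (?S B0) (?S (src Q0)) (precomp (src Q0) (arr Q0))" if "u \<in> {\<zero>\<^bsub>?S B0\<^esub>}" for u
      using that by (simp add: a_kernel_def')
  qed
  \<comment> \<open>Hence the source of the cokernel is \<open>X\<close> modulo its zero
    submodule.\<close>
  have I0: "precomp B1 g2 ` {\<zero>\<^bsub>?S B0\<^esub>} = {\<zero>\<^bsub>X\<^esub>}"
    using mod_hom_zero[OF SB0.left_module_axioms SB.left_module_axioms precomp_star[OF mods(4) homs(3)]]
    by (simp add: X_def)
  let ?Z = "{\<zero>\<^bsub>X\<^esub>}"
  interpret X: left_module ?K X by (rule X)
  note q0 = quotient_module_proj[OF X X.submodule_zero_set]
  define E where "E = H_coker (H_star L Q0) (H_star_map Q1 (g1, g2)) (H_star L Q1)"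
  have E: "src E = quotient_module X ?Z" "tgt E = quotient_module (?S B1) I"
      "arr E = (\<lambda>A. \<Union>y\<in>A. I +>\<^bsub>?S B1\<^esub> y)"
    using dom0 I0 by (simp_all add: E_def H_coker_def H_star_def H_star_map_def defs X_def N_def I_def)

  \<comment> \<open>The comparison maps and their commuting square\<close>
  define \<eta> where "\<eta> v = precomp B1 \<rho>0 (\<ominus>\<^bsub>?S P0\<^esub> v)" for v
  define \<psi>0 where "\<psi>0 v = ?Z +>\<^bsub>X\<^esub> \<eta> v" for v
  define \<psi>1 where "\<psi>1 u = I +>\<^bsub>?S B1\<^esub> precomp B1 \<rho>1 u" for u
  have "(\<lambda>v. \<ominus>\<^bsub>?S P0\<^esub> v) \<in> mod_hom ?K (?S P0) (?S P0)"
    by (rule mod_homI)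
      (auto simp: S0.M.minus_add S0.smult_r_minus)
  from mod_hom_comp[OF this precomp_star[OF mods(4) homs(5)]]
  have \<eta>: "\<eta> \<in> mod_hom ?K (?S P0) (?S B1)" by (simp add: \<eta>_def[abs_def])
  have \<eta>_apply: "\<eta> v b = \<ominus>\<^bsub>L\<^esub> (v (\<rho>0 b))" if "v \<in> carrier (?S P0)" "b \<in> carrier B1" for v b
    using that by (simp add: \<eta>_def star_obj_minus[OF mods(2)] cl)
  \<comment> \<open>\<open>\<rho>0\<close> kills the image of \<open>f1\<close>.\<close>
  have \<eta>N: "\<eta> v \<in> N" if v: "v \<in> carrier (?S P0)" for v
  proof -
    have "precomp A1 f1 (\<eta> v) = \<zero>\<^bsub>?S A1\<^esub>"
    proof (rule star_obj_ext)
      show "precomp A1 f1 (\<eta> v) \<in> carrier (?S A1)"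
        by (rule star[OF mods(3) homs(2)]) (rule mod_hom_closed[OF \<eta> v])
      show "\<zero>\<^bsub>?S A1\<^esub> \<in> carrier (?S A1)"
        using star_obj_module[OF mods(3)] by (simp add: left_module_def abelian_group_def abelian_monoid.zero_closed)
    qed (simp add: \<eta>_apply[OF v] cl \<rho>0 star_obj_zero[OF mods(2) v])
    then show ?thesis using mod_hom_closed[OF \<eta> v] by (simp add: N_def a_kernel_def')
  qed
  have \<eta>X: "\<eta> \<in> mod_hom ?K (?S P0) X"
    using \<eta> \<eta>N by (intro mod_homI) (auto simp: X_def mod_homD[OF \<eta>])
  have \<psi>0: "\<psi>0 \<in> mod_hom ?K (?S P0) (src E)"
    using mod_hom_comp[OF \<eta>X q0(1)] by (simp add: E \<psi>0_def[abs_def])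
  have \<psi>1: "\<psi>1 \<in> mod_hom ?K (?S P1) (tgt E)"
    using mod_hom_comp[OF precomp_star[OF mods(4) homs(4)] q(1)] by (simp add: E \<psi>1_def[abs_def])
  \<comment> \<open>Cosets of the zero submodule are singletons, so the union defining
    \<open>arr E\<close> can be evaluated directly.\<close>
  have \<psi>0_eq: "\<psi>0 v = {\<eta> v}" if "v \<in> carrier (?S P0)" for v
    using mod_hom_closed[OF \<eta>X that] by (simp add: \<psi>0_def a_r_coset_def')
  \<comment> \<open>Equality of cosets becomes a pointwise identity on \<open>B1\<close>, where
    \<open>t\<close> is the functional on \<open>B0\<close> by which the representatives differ. All
    later claims about \<open>\<psi>1\<close> go through this form.\<close>
  have \<psi>1_eq_iff: "I +>\<^bsub>?S B1\<^esub> w = \<psi>1 u \<longleftrightarrow> (\<exists>t\<in>carrier (?S B0). \<forall>b\<in>carrier B1. w b = t (g2 b) \<oplus>\<^bsub>L\<^esub> u (\<rho>1 b))"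
    if w: "w \<in> carrier (?S B1)" and u: "u \<in> carrier (?S P1)" for u w
  proof -
    have "w = precomp B1 g2 t \<oplus>\<^bsub>?S B1\<^esub> precomp B1 \<rho>1 u \<longleftrightarrow> (\<forall>b\<in>carrier B1. w b = t (g2 b) \<oplus>\<^bsub>L\<^esub> u (\<rho>1 b))"
      if t: "t \<in> carrier (?S B0)" for t
    proof
      assume "\<forall>b\<in>carrier B1. w b = t (g2 b) \<oplus>\<^bsub>L\<^esub> u (\<rho>1 b)"
      then show "w = precomp B1 g2 t \<oplus>\<^bsub>?S B1\<^esub> precomp B1 \<rho>1 u"
        by (intro star_obj_ext[OF w] SB.M.a_closed star[OF mods(4) homs(3) t] star[OF mods(4) homs(4) u]) simp
    qed simp
    then show ?thesis
      using quotient_module_coset_eq_iff[OF SB.left_module_axioms I w star[OF mods(4) homs(4) u]]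
      by (auto simp: \<psi>1_def I_def)
  qed
  have comm: "arr E (\<psi>0 v) = \<psi>1 (precomp P1 \<alpha> v)" if v: "v \<in> carrier (?S P0)" for v
  proof -
    have "arr E (\<psi>0 v) = I +>\<^bsub>?S B1\<^esub> \<eta> v" by (simp add: \<psi>0_eq[OF v] E)
    moreover have "I +>\<^bsub>?S B1\<^esub> \<eta> v = \<psi>1 (precomp P1 \<alpha> v)"
    proof (subst \<psi>1_eq_iff[OF mod_hom_closed[OF \<eta> v] star[OF mods(1) homs(1) v]], rule bexI)
      \<comment> \<open>With this \<open>t\<close>, the formula for \<open>\<theta>' g2\<close>
        gives \<open>t g2 = -(v \<alpha> \<rho>1 + v \<rho>0)\<close>; adding
        \<open>v \<alpha> \<rho>1\<close> leaves \<open>-v \<rho>0\<close>, which is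
        \<open>\<eta> v\<close>.\<close>
      let ?t = "precomp B0 \<theta>' (\<ominus>\<^bsub>?S P0\<^esub> v)"
      show "?t \<in> carrier (?S B0)" by (rule star[OF mods(5) homs(9) S0.M.a_inv_closed[OF v]])
      show "\<forall>b\<in>carrier B1. \<eta> v b = ?t (g2 b) \<oplus>\<^bsub>L\<^esub> precomp P1 \<alpha> v (\<rho>1 b)"
      proof
        fix b assume b: "b \<in> carrier B1"
        have "v (\<alpha> (\<rho>1 b)) \<in> carrier L" "v (\<rho>0 b) \<in> carrier L"
          using b by (auto intro!: star_obj_closed[OF v] cl)
        then have "\<ominus>\<^bsub>L\<^esub> v (\<rho>0 b) = \<ominus>\<^bsub>L\<^esub> (v (\<alpha> (\<rho>1 b)) \<oplus>\<^bsub>L\<^esub> v (\<rho>0 b)) \<oplus>\<^bsub>L\<^esub> v (\<alpha> (\<rho>1 b))"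
          by (simp add: P1.L.a_comm[of "v (\<alpha> (\<rho>1 b))" "v (\<rho>0 b)"] P1.L.minus_add P1.L.a_assoc P1.L.l_neg)
        then show "\<eta> v b = ?t (g2 b) \<oplus>\<^bsub>L\<^esub> precomp P1 \<alpha> v (\<rho>1 b)"
          using b by (simp add: \<eta>_apply[OF v] cl star_obj_minus[OF mods(2) v] \<theta>'g2 star_obj_add[OF v])
      qed
    qed
    ultimately show ?thesis by simp
  qed

  \<comment> \<open>Bijectivity on sources\<close>
  have inj0: "inj_on \<psi>0 (carrier (?S P0))"
  proof (rule inj_onI)
    fix v v' assume v: "v \<in> carrier (?S P0)" "v' \<in> carrier (?S P0)" "\<psi>0 v = \<psi>0 v'"
    then have "\<eta> v = \<eta> v'" by (simp add: \<psi>0_eq)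
    then have *: "\<ominus>\<^bsub>L\<^esub> (v (\<rho>0 b)) = \<ominus>\<^bsub>L\<^esub> (v' (\<rho>0 b))" if "b \<in> carrier B1" for b
      using that by (metis \<eta>_apply v(1,2))
    \<comment> \<open>\<open>\<sigma>\<close> is a section of \<open>\<rho>0\<close>, so
      \<open>v\<close> can be recovered from \<open>v \<rho>0\<close>.\<close>
    have "\<ominus>\<^bsub>L\<^esub> (v y) = \<ominus>\<^bsub>L\<^esub> (v' y)" if "y \<in> carrier P0" for y
      using *[of "\<sigma> y"] that by (simp add: cl \<rho>0)
    then have "v y = v' y" if "y \<in> carrier P0" for y
      using that v(1,2) by (metis P1.L.minus_minus star_obj_closed)
    then show "v = v'" by (rule star_obj_ext[OF v(1,2)])
  qed
  have surj0: "\<psi>0 ` carrier (?S P0) = carrier (src E)"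
  proof (intro equalityI subsetI)
    fix Y assume "Y \<in> carrier (src E)"
    then obtain w where w: "w \<in> carrier X" "Y = ?Z +>\<^bsub>X\<^esub> w" by (auto simp: E q0(2))
    then have wN: "w \<in> carrier (?S B1)" "precomp A1 f1 w = \<zero>\<^bsub>?S A1\<^esub>"
      by (auto simp: X_def N_def a_kernel_def')
    have w0: "w (f1 a) = \<zero>\<^bsub>L\<^esub>" if "a \<in> carrier A1" for a
      using fun_cong[OF wN(2), of a] that by simp
    \<comment> \<open>As \<open>w\<close> vanishes on the image of \<open>f1\<close>, the
      decomposition of \<open>b\<close> gives \<open>w = w \<sigma> \<rho>0\<close>; the sign
      cancels the one in \<open>\<eta>\<close>.\<close>
    define v where "v = \<ominus>\<^bsub>?S P0\<^esub> (precomp P0 \<sigma> w)"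
    have pv: "precomp P0 \<sigma> w \<in> carrier (?S P0)" by (rule star[OF mods(2) homs(7) wN(1)])
    then have v: "v \<in> carrier (?S P0)" by (simp add: v_def)
    have "\<eta> v = w"
    proof (rule star_obj_ext[OF mod_hom_closed[OF \<eta> v] wN(1)])
      fix b assume b: "b \<in> carrier B1"
      have "w b = w (f1 (\<kappa> (\<rho>1 b)) \<oplus>\<^bsub>B1\<^esub> \<sigma> (\<rho>0 b))" using dec[OF b] by simp
      also have "\<dots> = w (\<sigma> (\<rho>0 b))"
        using b by (simp add: star_obj_add[OF wN(1)] cl w0 star_obj_closed[OF wN(1)])
      finally show "\<eta> v b = w b"
        using b by (simp add: \<eta>_def v_def pv cl)
    qed
    then show "Y \<in> \<psi>0 ` carrier (?S P0)" using v w(2) by (auto simp: \<psi>0_def)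
  qed (auto intro: mod_hom_closed[OF \<psi>0])

  \<comment> \<open>Bijectivity on targets\<close>
  have inj1: "inj_on \<psi>1 (carrier (?S P1))"
  proof (rule inj_onI)
    fix u u' assume u: "u \<in> carrier (?S P1)" "u' \<in> carrier (?S P1)" "\<psi>1 u = \<psi>1 u'"
    have "I +>\<^bsub>?S B1\<^esub> precomp B1 \<rho>1 u = \<psi>1 u'" using u(3) by (simp add: \<psi>1_def)
    then obtain t where t: "t \<in> carrier (?S B0)"
      and eq: "\<And>b. b \<in> carrier B1 \<Longrightarrow> u (\<rho>1 b) = t (g2 b) \<oplus>\<^bsub>L\<^esub> u' (\<rho>1 b)"
      unfolding \<psi>1_eq_iff[OF star[OF mods(4) homs(4) u(1)] u(2)] by auto
    \<comment> \<open>On the image of \<open>\<sigma>\<close> the map \<open>\<rho>1\<close> is zero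
      and \<open>g2\<close> is \<open>\<theta>\<close>, so \<open>eq\<close> isolates
      \<open>t\<close> there. Once \<open>t\<close> is zero, the image of \<open>f1 \<kappa>\<close>
      gives \<open>u = u'\<close>.\<close>
    have "t z = \<zero>\<^bsub>L\<^esub>" if z: "z \<in> carrier B0" for z
      using eq[of "\<sigma> (\<theta>' z)"] z
      by (simp add: cl \<rho>1 g2 \<theta> star_obj_zero[OF mods(1)] u star_obj_closed[OF t])
    then have "u x = u' x" if x: "x \<in> carrier P1" for x
      using eq[of "f1 (\<kappa> x)"] x by (simp add: cl \<rho>1 star_obj_closed[OF u(2)])
    then show "u = u'" by (rule star_obj_ext[OF u(1,2)])
  qed
  have surj1: "\<psi>1 ` carrier (?S P1) = carrier (tgt E)"
  proof (intro equalityI subsetI)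
    fix Y assume "Y \<in> carrier (tgt E)"
    then obtain w where w: "w \<in> carrier (?S B1)" "Y = I +>\<^bsub>?S B1\<^esub> w" by (auto simp: E q(2))
    \<comment> \<open>Take \<open>t = w \<sigma> \<theta>'\<close>, which agrees with
      \<open>w\<close> on the summand \<open>P0\<close>. Then \<open>w - t g2\<close> factors
      through \<open>\<rho>1\<close>, and \<open>u\<close> is its restriction along
      \<open>f1 \<kappa>\<close>.\<close>
    define u where "u = precomp P1 (\<lambda>x. f1 (\<kappa> x)) w \<oplus>\<^bsub>?S P1\<^esub> \<ominus>\<^bsub>?S P1\<^esub> precomp P1 (\<lambda>x. \<sigma> (\<alpha> x)) w"
    have u12: "precomp P1 (\<lambda>x. f1 (\<kappa> x)) w \<in> carrier (?S P1)" "precomp P1 (\<lambda>x. \<sigma> (\<alpha> x)) w \<in> carrier (?S P1)"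
      by (rule star[OF mods(1) mod_hom_comp[OF homs(6,2)] w(1)],
          rule star[OF mods(1) mod_hom_comp[OF homs(1,7)] w(1)])
    then have u: "u \<in> carrier (?S P1)" by (simp add: u_def)
    have "I +>\<^bsub>?S B1\<^esub> w = \<psi>1 u"
    proof (subst \<psi>1_eq_iff[OF w(1) u], rule bexI)
      let ?t = "precomp B0 (\<lambda>z. \<sigma> (\<theta>' z)) w"
      show "?t \<in> carrier (?S B0)" by (rule star[OF mods(5) mod_hom_comp[OF homs(9,7)] w(1)])
      show "\<forall>b\<in>carrier B1. w b = ?t (g2 b) \<oplus>\<^bsub>L\<^esub> u (\<rho>1 b)"
      proof
        fix b assume b: "b \<in> carrier B1"
        let ?x = "w (f1 (\<kappa> (\<rho>1 b)))" and ?y = "w (\<sigma> (\<rho>0 b))" and ?z = "w (\<sigma> (\<alpha> (\<rho>1 b)))"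
        have c: "?x \<in> carrier L" "?y \<in> carrier L" "?z \<in> carrier L"
          using b by (auto intro!: star_obj_closed[OF w(1)] cl)
        have "w b = w (f1 (\<kappa> (\<rho>1 b)) \<oplus>\<^bsub>B1\<^esub> \<sigma> (\<rho>0 b))" using dec[OF b] by simp
        also have "\<dots> = ?x \<oplus>\<^bsub>L\<^esub> ?y" using b by (simp add: star_obj_add[OF w(1)] cl)
        \<comment> \<open>Adding and subtracting \<open>w \<sigma> \<alpha> \<rho>1\<close> allows
          the sum to be regrouped as \<open>t g2\<close> plus \<open>u \<rho>1\<close>.\<close>
        also have "\<dots> = (?x \<oplus>\<^bsub>L\<^esub> ?y) \<oplus>\<^bsub>L\<^esub> (?z \<oplus>\<^bsub>L\<^esub> \<ominus>\<^bsub>L\<^esub> ?z)"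
          using c by (simp add: P1.L.r_neg)
        also have "\<dots> = (?z \<oplus>\<^bsub>L\<^esub> ?y) \<oplus>\<^bsub>L\<^esub> (?x \<oplus>\<^bsub>L\<^esub> \<ominus>\<^bsub>L\<^esub> ?z)"
          using c by (simp add: P1.L.a_ac)
        also have "?z \<oplus>\<^bsub>L\<^esub> ?y = ?t (g2 b)"
          using b by (simp add: cl \<theta>'g2 mod_hom_add[OF homs(7)] star_obj_add[OF w(1)])
        also have "?x \<oplus>\<^bsub>L\<^esub> \<ominus>\<^bsub>L\<^esub> ?z = u (\<rho>1 b)"
          using b by (simp add: u_def cl star_obj_minus[OF mods(1) u12(2)])
        finally show "w b = ?t (g2 b) \<oplus>\<^bsub>L\<^esub> u (\<rho>1 b)" .
      qed
    qed
    then show "Y \<in> \<psi>1 ` carrier (?S P1)" using u w(2) by auto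
  qed (auto intro: mod_hom_closed[OF \<psi>1])
  show ?thesis
  proof (rule that[of \<psi>0 \<psi>1, folded E_def])
    show "(\<psi>0, \<psi>1) \<in> H_hom ?K \<lparr>src = ?S P0, tgt = ?S P1, arr = precomp P1 \<alpha>\<rparr> E"
      using \<psi>0 \<psi>1 comm by (simp add: H_hom_def)
  qed (simp_all add: bij_betw_def inj0 surj0 inj1 surj1)
qed

section \<open>Projective covers in the morphism category\<close>

lemma H_hom_id: "(\<lambda>x. x, \<lambda>y. y) \<in> H_hom L X X"
  by (simp add: H_hom_def mod_hom_id)

lemma H_homD:
  assumes "h \<in> H_hom L X Y"
  shows "fst h \<in> mod_hom L (src X) (src Y)" "snd h \<in> mod_hom L (tgt X) (tgt Y)"
    "\<And>x. x \<in> carrier (src X) \<Longrightarrow> arr Y (fst h x) = snd h (arr X x)"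
  using assms by (auto simp: H_hom_def)

text \<open>Morphisms see only the carrier of the ring. This returns the final isomorphism from
  \<open>opposite L\<close> to \<open>L\<close>.\<close>

lemma H_iso_opposite: "H_iso (opposite L) X Y \<longleftrightarrow> H_iso L X Y"
  by (simp add: H_iso_def H_hom_def mod_hom_def opposite_def)

text \<open>Minimality of the cover makes \<open>k\<close> epi, and projectivity then splits it.\<close>

lemma H_projective_cover_section:
  assumes cover: "H_projective_cover L Q q X" and M: "H_obj L M" and k: "k \<in> H_hom L M Q"
    and epi: "(\<lambda>x. fst q (fst k x)) ` carrier (src M) = carrier (src X)"
      "(\<lambda>y. snd q (snd k y)) ` carrier (tgt M) = carrier (tgt X)"
  obtains s where "s \<in> H_hom L Q M"
    "\<And>x. x \<in> carrier (src Q) \<Longrightarrow> fst k (fst s x) = x"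
    "\<And>y. y \<in> carrier (tgt Q) \<Longrightarrow> snd k (snd s y) = y"
proof -
  have Q: "H_obj L Q" "H_projective L Q" using cover by (auto simp: H_projective_cover_def H_projective_def)
  have mods: "left_module L (src M)" "left_module L (tgt M)" "left_module L (src Q)" "left_module L (tgt Q)"
    and arr: "arr M \<in> mod_hom L (src M) (tgt M)"
    using M Q(1) by (auto simp: H_obj_def fg_module_def)
  note kD = H_homD[OF k]
  have "H_subobject L Q (fst k ` carrier (src M)) (snd k ` carrier (tgt M))"
    unfolding H_subobject_def
    using submodule_image[OF mods(1,3) kD(1) left_module.submodule_carrier[OF mods(1)]]
      submodule_image[OF mods(2,4) kD(2) left_module.submodule_carrier[OF mods(2)]]
      kD(3) mod_hom_closed[OF arr] by auto
  then have "fst k ` carrier (src M) = carrier (src Q) \<and> snd k ` carrier (tgt M) = carrier (tgt Q)"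
    using cover epi unfolding H_projective_cover_def by (metis image_image)
  then have "H_epi L M k Q" using k by (simp add: H_epi_def)
  from H_projective_lift[OF Q(2) M Q(1) this H_hom_id] that show ?thesis by auto
qed

lemma projective_cover_to_zero:
  assumes C: "fg_module L C" and P0: "projective_cover L P0 \<pi> C"
    and Q0: "H_projective_cover L Q0 q (to_zero C)"
  obtains k where "k \<in> mod_hom L P0 (src Q0)" "bij_betw k (carrier P0) (carrier (src Q0))"
    "\<And>x. x \<in> carrier P0 \<Longrightarrow> fst q (k x) = \<pi> x"
    "bij_betw (arr Q0) (carrier (src Q0)) (carrier (tgt Q0))"
proof -
  have fg: "fg_module L P0" "fg_module L (src Q0)" "fg_module L (tgt Q0)" and f0: "arr Q0 \<in> mod_hom L (src Q0) (tgt Q0)"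
    and proj: "projective_module L P0" and \<pi>: "\<pi> \<in> mod_hom L P0 C" "\<pi> ` carrier P0 = carrier C"
    and q: "q \<in> H_hom L Q0 (to_zero C)" "fst q ` carrier (src Q0) = carrier C"
    using P0 Q0
    by (auto simp: projective_cover_def projective_module_def H_projective_cover_def H_projective_def
        H_obj_def H_epi_def to_zero_def)
  note q1 = H_homD(1)[OF q(1), unfolded to_zero_def, simplified]
  have mods: "left_module L C" "left_module L P0" "left_module L (src Q0)"
    using C fg by (auto simp: fg_module_def)
  obtain k where k: "k \<in> mod_hom L P0 (src Q0)" "\<And>x. x \<in> carrier P0 \<Longrightarrow> fst q (k x) = \<pi> x"
    using projective_module_lift[OF proj fg(2) mods(1) q1 q(2) \<pi>(1)] by blast
  let ?M = "\<lparr>src = P0, tgt = P0, arr = (\<lambda>x. x)\<rparr>"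
  have M: "H_obj L ?M" using fg(1) by (simp add: H_obj_def mod_hom_id)
  \<comment> \<open>The arrow of \<open>?M\<close> is the identity, so the first component
    \<open>k\<close> determines the second.\<close>
  have kM: "(k, \<lambda>x. arr Q0 (k x)) \<in> H_hom L ?M Q0"
    using k(1) mod_hom_comp[OF k(1) f0] by (simp add: H_hom_def)
  have "(\<lambda>x. fst q (k x)) ` carrier P0 = carrier C" using k(2) \<pi>(2) by simp
  \<comment> \<open>The target of \<open>to_zero C\<close> has a single element, so being onto it
    only requires \<open>P0\<close> to be nonempty.\<close>
  moreover have "\<zero>\<^bsub>P0\<^esub> \<in> carrier P0"
    by (rule left_module.submodule_zero[OF mods(2) left_module.submodule_carrier[OF mods(2)]])
  then have "(\<lambda>x. snd q (arr Q0 (k x))) ` carrier P0 = {()}" by (intro equalityI image_subsetI) auto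
  ultimately obtain s where s: "s \<in> H_hom L Q0 ?M" "\<And>x. x \<in> carrier (src Q0) \<Longrightarrow> k (fst s x) = x"
    "\<And>y. y \<in> carrier (tgt Q0) \<Longrightarrow> arr Q0 (k (snd s y)) = y"
    using H_projective_cover_section[OF Q0 M kM, unfolded to_zero_def zero_module_def, simplified] by blast
  note sD = H_homD[OF s(1), simplified]
  \<comment> \<open>Hence the image of \<open>fst s\<close> still maps onto \<open>C\<close>, and
    minimality of \<open>\<pi>\<close> makes it all of \<open>P0\<close>; the section is then
    inverse to \<open>k\<close>.\<close>
  have "\<pi> (fst s x) = fst q x" if "x \<in> carrier (src Q0)" for x
    using k(2)[of "fst s x"] s(2) that mod_hom_closed[OF sD(1)] by simp
  then have "\<pi> ` fst s ` carrier (src Q0) = carrier C" using q(2) by (auto simp: image_image)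
  moreover have "submodule (fst s ` carrier (src Q0)) L P0"
    by (rule submodule_image[OF mods(3,2) sD(1) left_module.submodule_carrier[OF mods(3)]])
  ultimately have surj: "fst s ` carrier (src Q0) = carrier P0"
    using P0 unfolding projective_cover_def by blast
  then have kb: "bij_betw k (carrier P0) (carrier (src Q0))"
  proof (intro bij_betwI[where g = "fst s"])
    fix x assume "x \<in> carrier P0"
    then obtain a where "a \<in> carrier (src Q0)" "x = fst s a" using surj by blast
    then show "fst s (k x) = x" using s(2) by simp
  qed (use s(2) mod_hom_closed[OF k(1)] surj in auto)
  \<comment> \<open>Because the arrow of \<open>?M\<close> is the identity, \<open>snd s\<close>
    after \<open>arr Q0\<close> is \<open>fst s\<close>, the inverse of \<open>k\<close>; so
    \<open>k\<close> after \<open>snd s\<close> inverts \<open>arr Q0\<close>.\<close>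
  have f0s: "fst s x = snd s (arr Q0 x)" if "x \<in> carrier (src Q0)" for x using sD(3)[OF that] .
  have "bij_betw (arr Q0) (carrier (src Q0)) (carrier (tgt Q0))"
  proof (rule bij_betwI[where g = "\<lambda>y. k (snd s y)"])
    fix x assume "x \<in> carrier (src Q0)"
    then show "k (snd s (arr Q0 x)) = x" using f0s s(2) by simp
  qed (use mod_hom_closed[OF f0] mod_hom_closed[OF k(1)] mod_hom_closed[OF sD(2)] s(3) in auto)
  with k kb that show ?thesis by blast
qed

text \<open>
  Compares \<open>Q1\<close> with \<open>(P1 \<rightarrow> P1 \<oplus> P0)\<close>: the splitting map hits all of \<open>P1\<close> by minimality of \<open>\<beta>\<close>,
  and then all of \<open>P0\<close> by minimality of \<open>\<pi>\<close>.
\<close>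

lemma kernel_object_cover:
  assumes P0: "projective_cover L P0 \<pi> C" and C: "left_module L C"
    and \<alpha>: "\<alpha> \<in> mod_hom L P1 P0" "\<And>x. x \<in> carrier P1 \<Longrightarrow> \<pi> (\<alpha> x) = \<zero>\<^bsub>C\<^esub>"
    and P1: "projective_cover L P1 \<beta> (src Y)"
    and Q1: "H_projective_cover L Q1 g Y" and Y: "left_module L (src Y)" "left_module L (tgt Y)"
    and \<theta>: "\<theta> \<in> mod_hom L P0 (tgt Y)" "bij_betw \<theta> (carrier P0) (carrier (tgt Y))"
      "\<And>x. x \<in> carrier P1 \<Longrightarrow> arr Y (\<beta> x) = \<theta> (\<alpha> x)"
  obtains \<kappa> \<sigma> \<rho>1 \<rho>0 where
    "\<kappa> \<in> mod_hom L P1 (src Q1)" "\<sigma> \<in> mod_hom L P0 (tgt Q1)"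
    "\<rho>1 \<in> mod_hom L (tgt Q1) P1" "\<rho>0 \<in> mod_hom L (tgt Q1) P0"
    "\<And>x. x \<in> carrier P1 \<Longrightarrow> \<rho>1 (arr Q1 (\<kappa> x)) = x" "\<And>y. y \<in> carrier P0 \<Longrightarrow> \<rho>1 (\<sigma> y) = \<zero>\<^bsub>P1\<^esub>"
    "\<And>a. a \<in> carrier (src Q1) \<Longrightarrow> \<rho>0 (arr Q1 a) = \<zero>\<^bsub>P0\<^esub>" "\<And>y. y \<in> carrier P0 \<Longrightarrow> \<rho>0 (\<sigma> y) = y"
    "\<And>b. b \<in> carrier (tgt Q1) \<Longrightarrow> b = arr Q1 (\<kappa> (\<rho>1 b)) \<oplus>\<^bsub>tgt Q1\<^esub> \<sigma> (\<rho>0 b)"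
    "\<And>x. x \<in> carrier P1 \<Longrightarrow> snd g (arr Q1 (\<kappa> x)) = \<theta> (\<alpha> x)" "\<And>y. y \<in> carrier P0 \<Longrightarrow> snd g (\<sigma> y) = \<theta> y"
proof -
  have proj: "projective_module L P1" "projective_module L P0" "H_projective L Q1" "H_epi L Q1 g Y"
    and fg: "fg_module L P1" "fg_module L P0" "fg_module L (src Q1)" "fg_module L (tgt Q1)"
    and f1: "arr Q1 \<in> mod_hom L (src Q1) (tgt Q1)"
    and \<pi>: "\<pi> \<in> mod_hom L P0 C" "\<pi> ` carrier P0 = carrier C"
    and \<beta>: "\<beta> \<in> mod_hom L P1 (src Y)" "\<beta> ` carrier P1 = carrier (src Y)"
    and g: "g \<in> H_hom L Q1 Y" "fst g ` carrier (src Q1) = carrier (src Y)" "snd g ` carrier (tgt Q1) = carrier (tgt Y)"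
    using P0 P1 Q1
    by (auto simp: projective_cover_def projective_module_def H_projective_cover_def H_projective_def
        H_obj_def H_epi_def)
  have mods: "left_module L P1" "left_module L P0" "left_module L (src Q1)" "left_module L (tgt Q1)"
    using fg by (auto simp: fg_module_def)
  interpret P1: left_module L P1 by (rule mods)
  interpret P0: left_module L P0 by (rule mods)
  interpret B1: left_module L "tgt Q1" by (rule mods)
  interpret C: left_module L C by (rule C)
  interpret Yt: left_module L "tgt Y" by (rule Y)
  note gD = H_homD[OF g(1)]
  \<comment> \<open>\<open>\<kappa>\<close> and \<open>\<sigma>\<close> lift the two given maps
    through \<open>g\<close>; together they define the comparison from
    \<open>(P1 \<rightarrow> P1 \<oplus> P0)\<close> to \<open>Q1\<close>.\<close>
  obtain \<kappa> where \<kappa>: "\<kappa> \<in> mod_hom L P1 (src Q1)" "\<And>x. x \<in> carrier P1 \<Longrightarrow> fst g (\<kappa> x) = \<beta> x"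
    using projective_module_lift[OF proj(1) fg(3) Y(1) gD(1) g(2) \<beta>(1)] by blast
  obtain \<sigma> where \<sigma>: "\<sigma> \<in> mod_hom L P0 (tgt Q1)" "\<And>x. x \<in> carrier P0 \<Longrightarrow> snd g (\<sigma> x) = \<theta> x"
    using projective_module_lift[OF proj(2) fg(4) Y(2) gD(2) g(3) \<theta>(1)] by blast
  note cl = mod_hom_closed[OF f1] mod_hom_closed[OF \<kappa>(1)] mod_hom_closed[OF \<sigma>(1)]
    mod_hom_closed[OF \<alpha>(1)] mod_hom_closed[OF \<theta>(1)] mod_hom_closed[OF \<pi>(1)]
  let ?M = "\<lparr>src = P1, tgt = prod_module P1 P0, arr = (\<lambda>x. (x, \<zero>\<^bsub>P0\<^esub>))\<rparr>"
  define k where "k = (\<lambda>(x, y). arr Q1 (\<kappa> x) \<oplus>\<^bsub>tgt Q1\<^esub> \<sigma> y)"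
  have f1\<kappa>: "(\<lambda>x. arr Q1 (\<kappa> x)) \<in> mod_hom L P1 (tgt Q1)" by (rule mod_hom_comp[OF \<kappa>(1) f1])
  have k: "k \<in> mod_hom L (prod_module P1 P0) (tgt Q1)"
    unfolding k_def by (rule mod_hom_copair[OF mods(4) f1\<kappa> \<sigma>(1)])
  have k_inl: "k (x, \<zero>\<^bsub>P0\<^esub>) = arr Q1 (\<kappa> x)" if "x \<in> carrier P1" for x
    using that by (simp add: k_def mod_hom_zero[OF mods(2,4) \<sigma>(1)] cl)
  have k_inr: "k (\<zero>\<^bsub>P1\<^esub>, y) = \<sigma> y" if "y \<in> carrier P0" for y
    using that by (simp add: k_def mod_hom_zero[OF mods(1,4) f1\<kappa>] cl)
  have g\<kappa>: "snd g (arr Q1 (\<kappa> x)) = \<theta> (\<alpha> x)" if "x \<in> carrier P1" for x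
    using gD(3)[of "\<kappa> x"] \<kappa>(2)[OF that] \<theta>(3)[OF that] that by (simp add: cl)
  have gk: "snd g (k (x, y)) = \<theta> (\<alpha> x \<oplus>\<^bsub>P0\<^esub> y)" if "x \<in> carrier P1" "y \<in> carrier P0" for x y
    using that by (simp add: k_def mod_hom_add[OF gD(2)] mod_hom_add[OF \<theta>(1)] cl g\<kappa> \<sigma>(2))
  have M: "H_obj L ?M" using fg fg_module_prod[OF fg(1,2)] mod_hom_inl[OF mods(1,2)] by (simp add: H_obj_def)
  have kM: "(\<kappa>, k) \<in> H_hom L ?M Q1" using \<kappa>(1) k k_inl by (simp add: H_hom_def)
  have "(\<lambda>x. fst g (\<kappa> x)) ` carrier P1 = carrier (src Y)" using \<beta>(2) \<kappa>(2) by simp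
  \<comment> \<open>The summand \<open>P0\<close> alone suffices, since there the map is
    \<open>\<theta>\<close>.\<close>
  moreover have "(\<lambda>w. snd g (k w)) ` (carrier P1 \<times> carrier P0) = carrier (tgt Y)"
  proof (intro equalityI subsetI)
    fix z assume "z \<in> carrier (tgt Y)"
    then obtain y where y: "y \<in> carrier P0" "z = \<theta> y" using \<theta>(2) by (auto simp: bij_betw_def)
    then have "snd g (k (\<zero>\<^bsub>P1\<^esub>, y)) = z" by (simp add: k_inr \<sigma>(2))
    then show "z \<in> (\<lambda>w. snd g (k w)) ` (carrier P1 \<times> carrier P0)" using y(1) by force
  qed (use mod_hom_closed[OF gD(2)] mod_hom_closed[OF k] in force)
  ultimately obtain s where s: "s \<in> H_hom L Q1 ?M" "\<And>x. x \<in> carrier (src Q1) \<Longrightarrow> \<kappa> (fst s x) = x"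
    "\<And>y. y \<in> carrier (tgt Q1) \<Longrightarrow> k (snd s y) = y"
    using H_projective_cover_section[OF Q1 M kM, simplified] by blast
  note sD = H_homD[OF s(1), simplified]
  have s2: "snd s b \<in> carrier P1 \<times> carrier P0" if "b \<in> carrier (tgt Q1)" for b
    using mod_hom_closed[OF sD(2) that] by simp
  have "\<beta> (fst s a) = fst g a" if "a \<in> carrier (src Q1)" for a
    using \<kappa>(2)[of "fst s a"] s(2) that mod_hom_closed[OF sD(1)] by simp
  then have "\<beta> ` fst s ` carrier (src Q1) = carrier (src Y)" using g(2) by (simp add: image_image)
  moreover have "submodule (fst s ` carrier (src Q1)) L P1"
    by (rule submodule_image[OF mods(3,1) sD(1) left_module.submodule_carrier[OF mods(3)]])
  ultimately have s1: "fst s ` carrier (src Q1) = carrier P1"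
    using P1 unfolding projective_cover_def by blast
  define U where "U = snd s ` carrier (tgt Q1)"
  have U: "submodule U L (prod_module P1 P0)"
    unfolding U_def
    by (rule submodule_image[OF mods(4) left_module_prod[OF mods(1,2)] sD(2) B1.submodule_carrier])
  \<comment> \<open>The section commutes with the arrows and the arrow of \<open>?M\<close> is the
    first inclusion, so surjectivity of \<open>fst s\<close> puts the whole summand
    \<open>P1\<close> into \<open>U\<close>.\<close>
  have U1: "(x, \<zero>\<^bsub>P0\<^esub>) \<in> U" if x: "x \<in> carrier P1" for x
  proof -
    obtain a where a: "a \<in> carrier (src Q1)" "x = fst s a" using x s1 by blast
    then show ?thesis unfolding U_def using sD(3)[OF a(1)] cl(1)[OF a(1)] by (metis image_eqI)
  qed
  have "submodule (snd ` U) L P0"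
    by (rule submodule_image[OF left_module_prod[OF mods(1,2)] mods(2) mod_hom_snd U])
  \<comment> \<open>A preimage \<open>b\<close> of \<open>\<theta> y\<close> under
    \<open>snd g\<close> has components with \<open>y = \<alpha> x' + y'\<close>; since
    \<open>\<pi> \<alpha>\<close> is zero, \<open>y'\<close> has the same image in \<open>C\<close>
    as \<open>y\<close>.\<close>
  moreover have "\<pi> ` snd ` U = carrier C"
  proof (intro equalityI subsetI)
    fix c assume "c \<in> carrier C"
    then obtain y where y: "y \<in> carrier P0" "c = \<pi> y" using \<pi>(2) by blast
    then obtain b where b: "b \<in> carrier (tgt Q1)" "snd g b = \<theta> y" using g(3) cl(5) by (metis imageE)
    obtain x' y' where xy: "snd s b = (x', y')" "x' \<in> carrier P1" "y' \<in> carrier P0" using s2[OF b(1)] by auto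
    have "\<theta> y = \<theta> (\<alpha> x' \<oplus>\<^bsub>P0\<^esub> y')" using s(3)[OF b(1)] gk[OF xy(2,3)] b(2) xy(1) by simp
    then have "y = \<alpha> x' \<oplus>\<^bsub>P0\<^esub> y'"
      using \<theta>(2) y(1) xy(2,3) by (auto simp: bij_betw_def cl dest: inj_onD)
    then have "c = \<pi> y'" using y(2) xy(2,3) by (simp add: mod_hom_add[OF \<pi>(1)] \<alpha>(2) cl)
    moreover have "y' \<in> snd ` U" using b(1) xy(1) unfolding U_def by (metis image_eqI snd_conv)
    ultimately show "c \<in> \<pi> ` snd ` U" by blast
  next
    fix c assume "c \<in> \<pi> ` snd ` U"
    then show "c \<in> carrier C" unfolding U_def using s2 cl(6) by fastforce
  qed
  ultimately have U0: "snd ` U = carrier P0" using P0 unfolding projective_cover_def by blast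
  \<comment> \<open>\<open>U\<close> is the whole product: some \<open>(x', y)\<close> lies in
    \<open>U\<close>, and \<open>(x, y)\<close> differs from it by an element of the summand
    \<open>P1\<close>. So \<open>s\<close> is a two-sided inverse of \<open>k\<close> on
    targets.\<close>
  have sk: "snd s (k (x, y)) = (x, y)" if x: "x \<in> carrier P1" and y: "y \<in> carrier P0" for x y
  proof -
    obtain x' where x': "(x', y) \<in> U" using y U0 by force
    then have "x' \<in> carrier P1" using left_module.submodule_subset[OF left_module_prod[OF mods(1,2)] U] by auto
    then have "(x \<oplus>\<^bsub>P1\<^esub> \<ominus>\<^bsub>P1\<^esub> x', \<zero>\<^bsub>P0\<^esub>) \<oplus>\<^bsub>prod_module P1 P0\<^esub> (x', y) = (x, y)"
      using x y by (simp add: P1.M.a_assoc P1.M.l_neg)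
    moreover have "(x \<oplus>\<^bsub>P1\<^esub> \<ominus>\<^bsub>P1\<^esub> x', \<zero>\<^bsub>P0\<^esub>) \<in> U" using U1 x \<open>x' \<in> carrier P1\<close> by simp
    ultimately have "(x, y) \<in> U"
      using left_module.submodule_add[OF left_module_prod[OF mods(1,2)] U _ x'] by metis
    then show ?thesis unfolding U_def using s(3) by auto
  qed
  show ?thesis
  \<comment> \<open>The projections are the two components of \<open>snd s\<close>;
    \<open>\<rho>0\<close> kills the image of \<open>arr Q1\<close> because the arrow of
    \<open>?M\<close> has second component zero.\<close>
  proof (rule that[of \<kappa> \<sigma> "\<lambda>b. fst (snd s b)" "\<lambda>b. snd (snd s b)"])
    show "(\<lambda>b. fst (snd s b)) \<in> mod_hom L (tgt Q1) P1" by (rule mod_hom_comp[OF sD(2) mod_hom_fst])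
    show "(\<lambda>b. snd (snd s b)) \<in> mod_hom L (tgt Q1) P0" by (rule mod_hom_comp[OF sD(2) mod_hom_snd])
    show "fst (snd s (arr Q1 (\<kappa> x))) = x" if "x \<in> carrier P1" for x
      using sk[OF that P0.M.zero_closed] k_inl[OF that] by simp
    show "fst (snd s (\<sigma> y)) = \<zero>\<^bsub>P1\<^esub>" "snd (snd s (\<sigma> y)) = y" if "y \<in> carrier P0" for y
      using sk[OF P1.M.zero_closed that] k_inr[OF that] by simp_all
    show "snd (snd s (arr Q1 a)) = \<zero>\<^bsub>P0\<^esub>" if "a \<in> carrier (src Q1)" for a
      using sD(3)[OF that] by (metis snd_conv)
    show "b = arr Q1 (\<kappa> (fst (snd s b))) \<oplus>\<^bsub>tgt Q1\<^esub> \<sigma> (snd (snd s b))" if "b \<in> carrier (tgt Q1)" for b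
      using s(3)[OF that] by (simp add: k_def case_prod_beta)
  qed (use \<kappa>(1) \<sigma> g\<kappa> in auto)
qed

theorem proposition2p2:
  fixes R :: "('r, 'm) ring_scheme" and L :: "('l, 'n) ring_scheme" and \<phi> :: "'r \<Rightarrow> 'l"
    and J :: "('r, 'j) module"
    and C :: "('l, 'c) module" and P1 :: "('l, 'p1) module" and P0 :: "('l, 'p0) module"
    and \<alpha> :: "'p1 \<Rightarrow> 'p0" and \<pi> :: "'p0 \<Rightarrow> 'c"
    and Q1 :: "('l, 'a1, 'b1) mor_obj" and Q0 :: "('l, 'a0, 'b0) mor_obj"
    and g :: "('a1 \<Rightarrow> 'a0) \<times> ('b1 \<Rightarrow> 'b0)" and q :: "('a0 \<Rightarrow> 'c) \<times> ('b0 \<Rightarrow> unit)"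
  assumes "artin_algebra R L \<phi>"
    and "dualizing_module R J"
    and "fg_module L C"
    and "minimal_projective_presentation L P1 \<alpha> P0 \<pi> C"
    and "H_minimal_projective_presentation L Q1 g Q0 q (to_zero C)"
  shows "H_iso L (AR_translate R \<phi> J L Q1 g Q0) (nakayama_mor R \<phi> J L P1 \<alpha> P0)"
proof -
  interpret artin_algebra R L \<phi> by fact
  let ?K = "a_kernel P0 C \<pi>"
  have P0: "projective_cover L P0 \<pi> C" and P1: "projective_cover L P1 \<alpha> (sub_module P0 ?K)"
    using assms(4) by (auto simp: minimal_projective_presentation_def)
  define Y where "Y = H_kernel Q0 q (to_zero C)"
  have Q0: "H_projective_cover L Q0 q (to_zero C)" and Q1: "H_projective_cover L Q1 g Y"
    using assms(5) by (auto simp: H_minimal_projective_presentation_def Y_def)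
  have C: "left_module L C" using assms(3) by (simp add: fg_module_def)
  have mods: "left_module L P0" "left_module L P1" "left_module L (src Q0)" "left_module L (tgt Q0)"
      "left_module L (src Q1)" "left_module L (tgt Q1)"
    and homs: "arr Q0 \<in> mod_hom L (src Q0) (tgt Q0)" "arr Q1 \<in> mod_hom L (src Q1) (tgt Q1)"
      "\<pi> \<in> mod_hom L P0 C" "\<alpha> \<in> mod_hom L P1 (sub_module P0 ?K)"
    and q: "q \<in> H_hom L Q0 (to_zero C)" and g: "g \<in> H_hom L Q1 Y"
    using P0 P1 Q0 Q1
    by (auto simp: projective_cover_def projective_module_def H_projective_cover_def H_projective_def
        H_obj_def H_epi_def fg_module_def)
  note q1 = H_homD(1)[OF q, unfolded to_zero_def, simplified]
  have \<alpha>: "\<alpha> \<in> mod_hom L P1 P0" and \<pi>\<alpha>: "\<And>x. x \<in> carrier P1 \<Longrightarrow> \<pi> (\<alpha> x) = \<zero>\<^bsub>C\<^esub>"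
    using homs(4) by (auto simp: mod_hom_def a_kernel_def')
  obtain k where k: "k \<in> mod_hom L P0 (src Q0)" "bij_betw k (carrier P0) (carrier (src Q0))"
      "\<And>x. x \<in> carrier P0 \<Longrightarrow> fst q (k x) = \<pi> x"
    and f0: "bij_betw (arr Q0) (carrier (src Q0)) (carrier (tgt Q0))"
    using projective_cover_to_zero[OF assms(3) P0 Q0] by blast
  have Y: "src Y = sub_module (src Q0) (a_kernel (src Q0) C (fst q))" "tgt Y = tgt Q0" "arr Y = arr Q0"
    by (simp_all add: Y_def H_kernel_def H_sub_def to_zero_def zero_module_def a_kernel_def')
  \<comment> \<open>\<open>fst q\<close> after \<open>k\<close> is \<open>\<pi>\<close>, so
    \<open>k\<close> identifies the kernel of \<open>\<pi>\<close> with the source of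
    \<open>Y\<close>.\<close>
  have kK: "k ` ?K = a_kernel (src Q0) C (fst q)"
  proof (intro equalityI subsetI)
    fix x assume x: "x \<in> a_kernel (src Q0) C (fst q)"
    then obtain y where "y \<in> carrier P0" "x = k y"
      using k(2) by (auto simp: a_kernel_def' bij_betw_def)
    with x show "x \<in> k ` ?K" using k(3) by (auto simp: a_kernel_def')
  qed (use k(3) mod_hom_closed[OF k(1)] in \<open>auto simp: a_kernel_def'\<close>)
  have srcY: "left_module L (src Y)"
    unfolding Y by (rule left_module_sub_module[OF mods(3) submodule_kernel[OF mods(3) C q1]])
  have k\<alpha>: "projective_cover L P1 (\<lambda>x. k (\<alpha> x)) (src Y)"
  proof -
    have K: "?K \<subseteq> carrier P0" by (auto simp: a_kernel_def')
    have \<alpha>K: "\<alpha> ` carrier P1 = ?K" using P1 by (simp add: projective_cover_def)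
    have "(\<lambda>x. k (\<alpha> x)) \<in> mod_hom L P1 (src Y)"
      using mod_hom_comp[OF \<alpha> k(1)] k(3) \<pi>\<alpha> mod_hom_closed[OF \<alpha>] mod_hom_closed[OF k(1)]
      by (auto simp: mod_hom_def Y a_kernel_def')
    moreover have "(\<lambda>x. k (\<alpha> x)) ` carrier P1 = carrier (src Y)"
      using kK \<alpha>K by (simp add: Y flip: image_image)
    \<comment> \<open>Injectivity of \<open>k\<close> cancels it from the hypothesis on
      \<open>N\<close>, which leaves the minimality of \<open>\<alpha>\<close> as a cover of the
      kernel of \<open>\<pi>\<close>.\<close>
    moreover have "N = carrier P1" if N: "submodule N L P1" "(\<lambda>x. k (\<alpha> x)) ` N = carrier (src Y)" for N
    proof -
      have "N \<subseteq> carrier P1" by (rule left_module.submodule_subset[OF mods(2) N(1)])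
      then have "\<alpha> ` N \<subseteq> carrier P0" using mod_hom_closed[OF \<alpha>] by auto
      moreover have "k ` \<alpha> ` N = k ` ?K" using N(2) kK by (simp add: Y image_image)
      ultimately have "\<alpha> ` N = ?K"
        using inj_on_image_eq_iff[OF bij_betw_imp_inj_on[OF k(2)], of "\<alpha> ` N" ?K] K by simp
      then show ?thesis using P1 N(1) by (simp add: projective_cover_def)
    qed
    ultimately show ?thesis using P1 by (simp add: projective_cover_def)
  qed
  \<comment> \<open>Identifies \<open>P0\<close> with the target of \<open>Q0\<close>, which is also
    the target of \<open>Y\<close>. The square required of \<open>\<theta>\<close> then holds by
    definition, as \<open>Y\<close> has the arrow of \<open>Q0\<close>.\<close>
  define \<theta> where "\<theta> x = arr Q0 (k x)" for x
  have \<theta>: "\<theta> \<in> mod_hom L P0 (tgt Q0)" "bij_betw \<theta> (carrier P0) (carrier (tgt Q0))"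
    using mod_hom_comp[OF k(1) homs(1)] bij_betw_trans[OF k(2) f0] by (simp_all add: \<theta>_def[abs_def] comp_def)
  have \<theta>': "inv_into (carrier P0) \<theta> \<in> mod_hom L (tgt Q0) P0" by (rule mod_hom_inv_into[OF mods(1) \<theta>])
  have \<theta>'\<theta>: "\<And>y. y \<in> carrier P0 \<Longrightarrow> inv_into (carrier P0) \<theta> (\<theta> y) = y"
    "\<And>z. z \<in> carrier (tgt Q0) \<Longrightarrow> \<theta> (inv_into (carrier P0) \<theta> z) = z"
    using \<theta>(2) by (simp_all add: bij_betw_def f_inv_into_f)
  have f0s: "arr Q0 ` carrier (src Q0) = carrier (tgt Q0)" using f0 by (simp add: bij_betw_def)
  obtain \<kappa> \<sigma> \<rho>1 \<rho>0 where data: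
    "\<kappa> \<in> mod_hom L P1 (src Q1)" "\<sigma> \<in> mod_hom L P0 (tgt Q1)"
    "\<rho>1 \<in> mod_hom L (tgt Q1) P1" "\<rho>0 \<in> mod_hom L (tgt Q1) P0"
    "\<And>x. x \<in> carrier P1 \<Longrightarrow> \<rho>1 (arr Q1 (\<kappa> x)) = x" "\<And>y. y \<in> carrier P0 \<Longrightarrow> \<rho>1 (\<sigma> y) = \<zero>\<^bsub>P1\<^esub>"
    "\<And>a. a \<in> carrier (src Q1) \<Longrightarrow> \<rho>0 (arr Q1 a) = \<zero>\<^bsub>P0\<^esub>" "\<And>y. y \<in> carrier P0 \<Longrightarrow> \<rho>0 (\<sigma> y) = y"
    "\<And>b. b \<in> carrier (tgt Q1) \<Longrightarrow> b = arr Q1 (\<kappa> (\<rho>1 b)) \<oplus>\<^bsub>tgt Q1\<^esub> \<sigma> (\<rho>0 b)"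
    "\<And>x. x \<in> carrier P1 \<Longrightarrow> snd g (arr Q1 (\<kappa> x)) = \<theta> (\<alpha> x)" "\<And>y. y \<in> carrier P0 \<Longrightarrow> snd g (\<sigma> y) = \<theta> y"
    by (rule kernel_object_cover[OF P0 C \<alpha> \<pi>\<alpha> k\<alpha> Q1 srcY, unfolded Y(2,3),
          OF _ mods(4) \<theta> \<theta>_def[symmetric]])
      (assumption | rule that)+
  let ?X = "\<lparr>src = star_obj L P0, tgt = star_obj L P1, arr = precomp P1 \<alpha>\<rparr>"
  let ?E = "H_coker (H_star L Q0) (H_star_map Q1 g) (H_star L Q1)"
  obtain \<psi>0 \<psi>1 where \<psi>: "(\<psi>0, \<psi>1) \<in> H_hom (opposite L) ?X ?E"
    "bij_betw \<psi>0 (carrier (star_obj L P0)) (carrier (src ?E))"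
    "bij_betw \<psi>1 (carrier (star_obj L P1)) (carrier (tgt ?E))"
    by (rule coker_star_iso[where ?g1.0 = "fst g" and ?g2.0 = "snd g", unfolded prod.collapse,
          OF mods(2,1,5,6,4) \<alpha> homs(2) H_homD(2)[OF g, unfolded Y(2)] data(3,4,1,2) \<theta>(1) \<theta>' f0s data(5-11) \<theta>'\<theta>])
      (assumption | rule that)+
  \<comment> \<open>The cokernel lives over \<open>opposite L\<close>, so the duality is applied
    with that ring.\<close>
  have \<phi>: "\<phi> \<in> carrier R \<rightarrow> carrier (opposite L)"
    using structure_map by (auto simp: ring_hom_def opposite_def)
  have "H_iso (opposite L) (H_D R \<phi> J ?E) (H_D R \<phi> J ?X)"
    using mod_hom_closed[OF precomp_star[OF mods(2) \<alpha>]]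
    by (intro H_iso_H_D[OF _ _ \<psi>(1) _ _ _ \<phi>]) (auto simp: \<psi>(2,3) star_obj_module mods)
  \<comment> \<open>\<open>?X\<close> is the map \<open>\<alpha>\<^sup>*\<close>; its dual unfolds
    to \<open>\<nu>(\<alpha>)\<close>, and the exchange of source and target puts
    \<open>\<nu> P1\<close> first.\<close>
  moreover have "H_D R \<phi> J ?X = nakayama_mor R \<phi> J L P1 \<alpha> P0"
    by (simp add: H_D_def nakayama_mor_def nakayama_obj_def nakayama_map_def[abs_def])
  ultimately show ?thesis by (simp add: H_iso_opposite AR_translate_def)
qed

end
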